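(* Let $h,c$ be nonnegative integers, let $k$ be an integer with $1\le k\le 2^h$, and let $u$ be an integer with $1 \le u \le 2^{\nu(k)}$. (i) If $u<k$, then $\nu(S(c2^h+u,k)) \ge \nu(k)+\sigma(k)-\nu(u)-2$. (ii) If moreover $c\ge 1$ and $u<k$, then $\nu(S(c2^h+u,k)) = \nu(k)+\sigma(k)-\nu(u)-2$ if and only if $u=1$, or $u$ is even with $1\le u\le 2^{\nu(k)-1}$, or $u = 1+2^{\nu(k)-1}$, or $u=2^{\nu(k)}$. (iii) If $u=k$ (so that $\sigma(k)=1$), then $\nu(S(c2^h+u,k))=0$.
   Context: $S(n,k)$ denotes the Stirling number of the second kind, $\nu$ the $2$-adic valuation, and $\sigma(m)$ the sum of the base-$2$ digits of $m$. *)

theory Defs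
  imports
    "HOL-Combinatorics.Stirling"
    "HOL-Computational_Algebra.Primes"
    "HOL-Library.Extended_Real"
begin

text \<open>
  The 2-adic valuation with \<open>\<nu>(0) = \<infinity>\<close>.  The library's \<open>multiplicity 2 0\<close> is \<open>0\<close>, which is the
  wrong convention for vanishing Stirling numbers.
\<close>

definition nu2 :: "nat \<Rightarrow> ereal" where
  "nu2 n = (if n = 0 then \<infinity> else ereal (real (multiplicity 2 n)))"

fun binary_digit_sum :: "nat \<Rightarrow> nat" where
  "binary_digit_sum m = (if m = 0 then 0 else m mod 2 + binary_digit_sum (m div 2))"

declare binary_digit_sum.simps [simp del]

end

theory Submission
  imports Defs "HOL-Computational_Algebra.Polynomial"
begin

text \<open>
  Split \<open>(-1) ^ k k! S(n, k) = (\<Sum>x\<le>k. (-1) ^ x (k choose x) x ^ n)\<close> into the part \<open>k! E(n)\<close> of the even \<open>x\<close>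
  and the part \<open>k! F(n)\<close> of the odd \<open>x\<close>, so that \<open>S(n, k) = \<plusminus> (E(n) - F(n))\<close>. For \<open>n = c 2 ^ h + u\<close> with
  \<open>c \<ge> 1\<close> the even part \<open>E(n)\<close> is negligible, while \<open>F\<close> is 2-adically so close to being periodic
  that \<open>F(n)\<close> may be replaced by \<open>F(u)\<close>. Since \<open>u < k\<close> gives \<open>S(u, k) = 0\<close>, we have \<open>F(u) = E(u)\<close>, and
  \<open>E(u)\<close> is an explicit sum over \<open>S(u, l)\<close>, \<open>l \<le> u\<close>, whose valuation can be read off: only the terms
  \<open>l = u\<close> and \<open>l = u - 1\<close> matter.

  The stability of \<open>F\<close> is the main point. On odd \<open>x\<close> the power \<open>x ^ n\<close> is interpolated by the powers
  \<open>x ^ m\<close>, \<open>m < k\<close>, \<open>m \<equiv> n (mod 2)\<close>, up to a multiple of \<open>(x ^ 2 - 1) ^ (k div 2)\<close>, which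
  contributes only high powers of 2; at the nodes again \<open>F(m) = E(m)\<close>. The Lagrange coefficient at
  \<open>m\<close> carries a binomial coefficient that makes up exactly for the small valuation \<open>E(m)\<close> may have.
\<close>

text \<open>The constant e = \<nu>(k) + \<sigma>(k) - \<nu>(u) - 2 is the valuation of the summand l
  = u of E(u). Legendre's formula gives \<nu>(k) + \<sigma>(k) - 2 plus the difference \<sigma>(k -
  2u) - \<sigma>(k - u - 1), which is -\<nu>(u) if u is at most half of 2^\<nu>(k) or equal to
  2^\<nu>(k); in between, one more factor 2 appears and e is no longer attained. All other
  contributions are needed only up to e + 1. No single lower bound for S(m, l) controls E(m) at all
  interpolation nodes m. The bound \<sigma>(l) - \<sigma>(m) and the bound \<nu>(l) - \<nu>(m) - 1
  complement each other, and a carry condition decides which one to use. Interpolation works for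
  even k and u < 2^\<nu>(k) only. The remaining cases, odd k and u = 2^\<nu>(k), are reduced to
  exponents 0 and 1 by trading factors x for changes of k, through x (k choose x) = k ((k choose x)
  - ((k - 1) choose x)).\<close>

abbreviation dyadic_val :: "nat \<Rightarrow> int" ("\<nu>")
  where "\<nu> n \<equiv> int (multiplicity 2 n)"

abbreviation digit_sum :: "nat \<Rightarrow> int" ("\<sigma>")
  where "\<sigma> n \<equiv> int (binary_digit_sum n)"

section \<open>Binary digit sums\<close>

lemma digit_sum_0 [simp]: "binary_digit_sum 0 = 0"
  by (simp add: binary_digit_sum.simps)

lemma digit_sum_double [simp]: "binary_digit_sum (2 * m) = binary_digit_sum m"
  by (subst binary_digit_sum.simps) simp

lemma digit_sum_double_Suc [simp]: "binary_digit_sum (Suc (2 * m)) = Suc (binary_digit_sum m)"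
  by (subst binary_digit_sum.simps) simp

lemma digit_sum_double_Suc' [simp]: "binary_digit_sum (2 * m + 1) = binary_digit_sum m + 1"
  using digit_sum_double_Suc[of m] by simp

lemma digit_sum_1 [simp]: "binary_digit_sum (Suc 0) = 1"
  using digit_sum_double_Suc[of 0] by simp

lemma multiplicity_two_double: "m > 0 \<Longrightarrow> multiplicity 2 (2 * m) = Suc (multiplicity 2 (m::nat))"
  by (simp add: multiplicity_times_same)

lemma multiplicity_two_odd: "odd m \<Longrightarrow> multiplicity 2 (m::nat) = 0"
  by (simp add: not_dvd_imp_multiplicity_0)

text \<open>Adding 1 turns the \<nu>(n + 1) trailing ones of n into zeros and the next zero into a
  one. This is Legendre's formula in differenced form.\<close>

lemma digit_sum_Suc: "\<sigma> (Suc n) + \<nu> (Suc n) = \<sigma> n + 1"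
proof (induction n rule: less_induct)
  case (less n)
  show ?case
  proof (cases "even n")
    case True
    then obtain m where "n = 2 * m" by blast
    then show ?thesis by (simp add: multiplicity_two_odd)
  next
    case False
    then obtain m where m: "n = 2 * m + 1" by (rule oddE)
    then have *: "Suc n = 2 * Suc m" by simp
    have "\<sigma> (Suc m) + \<nu> (Suc m) = \<sigma> m + 1" using less m by simp
    moreover have "\<sigma> n = \<sigma> m + 1" unfolding m by simp
    moreover have "\<sigma> (Suc n) = \<sigma> (Suc m)" unfolding * by (simp only: digit_sum_double)
    moreover have "\<nu> (Suc n) = \<nu> (Suc m) + 1" unfolding * by (subst multiplicity_two_double) simp_all
    ultimately show ?thesis by linarith
  qed
qed

lemma digit_sum_pred: "n \<ge> 1 \<Longrightarrow> \<sigma> (n - 1) = \<sigma> n + \<nu> n - 1"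
  using digit_sum_Suc[of "n - 1"] by simp

lemma digit_sum_add_le: "\<sigma> (a + b) \<le> \<sigma> a + \<sigma> b"
proof (induction "a + b" arbitrary: a b rule: less_induct)
  case less
  show ?case
  proof (cases "a = 0 \<or> b = 0")
    case False
    then have pos: "a > 0" "b > 0" by auto
    define a' b' where "a' = a div 2" and "b' = b div 2"
    have IH: "\<sigma> (a' + b') \<le> \<sigma> a' + \<sigma> b'"
      by (rule less) (use pos in \<open>auto simp: a'_def b'_def\<close>)
    consider "a = 2 * a'" "b = 2 * b'" | "a = 2 * a'" "b = 2 * b' + 1"
      | "a = 2 * a' + 1" "b = 2 * b'" | "a = 2 * a' + 1" "b = 2 * b' + 1"
      unfolding a'_def b'_def by arith
    then show ?thesis
    proof cases
      case 1
      then have "a + b = 2 * (a' + b')" by simp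
      then show ?thesis using IH 1 by (simp only: digit_sum_double)
    next
      case 2
      then have *: "a + b = 2 * (a' + b') + 1" by simp
      show ?thesis unfolding * digit_sum_double_Suc' using IH 2 by simp
    next
      case 3
      then have *: "a + b = 2 * (a' + b') + 1" by simp
      show ?thesis unfolding * digit_sum_double_Suc' using IH 3 by simp
    next
      case 4
      then have *: "a + b = 2 * (Suc (a' + b'))" by simp
      have "\<sigma> (Suc (a' + b')) \<le> \<sigma> (a' + b') + 1"
        using digit_sum_Suc[of "a' + b'"] by linarith
      then show ?thesis unfolding * digit_sum_double using IH 4 by simp
    qed
  qed auto
qed

lemma digit_sum_diff_le: "b \<le> a \<Longrightarrow> \<sigma> a \<le> \<sigma> (a - b) + \<sigma> b"
  using digit_sum_add_le[of "a - b" b] by simp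

lemma digit_sum_le: "\<sigma> n \<le> int n"
proof (induction n)
  case (Suc n)
  then show ?case using digit_sum_Suc[of n] by linarith
qed simp

lemma digit_sum_pos: "n > 0 \<Longrightarrow> \<sigma> n \<ge> 1"
proof (induction n rule: less_induct)
  case (less n)
  show ?case
  proof (cases "even n")
    case True
    then obtain m where "n = 2 * m" by blast
    then show ?thesis using less by auto
  next
    case False
    then obtain m where "n = 2 * m + 1" by (rule oddE)
    then show ?thesis by simp
  qed
qed

text \<open>The least number with s binary ones is 2^s - 1. This makes digit sums logarithmic in the
  size estimates below.\<close>

lemma two_power_digit_sum_le: "2 ^ binary_digit_sum n \<le> Suc n"
proof (induction n rule: less_induct)
  case (less n)
  show ?case
  proof (cases "n = 0")
    case False
    show ?thesis
    proof (cases "even n")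
      case True
      then obtain m where "n = 2 * m" by blast
      then show ?thesis using less[of m] False by simp
    next
      case odd: False
      then obtain m where m: "n = 2 * m + 1" by (rule oddE)
      then show ?thesis using less[of m] by simp
    qed
  qed simp
qed

lemma digit_sum_split: "r < 2 ^ a \<Longrightarrow> binary_digit_sum (2 ^ a * q + r) = binary_digit_sum q + binary_digit_sum r"
proof (induction a arbitrary: r)
  case (Suc a)
  show ?case
  proof (cases "even r")
    case True
    then obtain t where t: "r = 2 * t" by blast
    then have "binary_digit_sum (2 ^ a * q + t) = binary_digit_sum q + binary_digit_sum t"
      using Suc by simp
    moreover have "2 ^ Suc a * q + r = 2 * (2 ^ a * q + t)" using t by simp
    ultimately show ?thesis using t by (simp only: digit_sum_double)
  next
    case False
    then obtain t where t: "r = 2 * t + 1" by (rule oddE)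
    then have "binary_digit_sum (2 ^ a * q + t) = binary_digit_sum q + binary_digit_sum t"
      using Suc by simp
    moreover have "2 ^ Suc a * q + r = 2 * (2 ^ a * q + t) + 1" using t by simp
    ultimately show ?thesis using t by (simp only: digit_sum_double_Suc')
  qed
qed simp

lemma digit_sum_mult_power [simp]: "binary_digit_sum (2 ^ a * q) = binary_digit_sum q"
  using digit_sum_split[of 0 a q] by simp

lemma digit_sum_complement: "r < 2 ^ a \<Longrightarrow> \<sigma> (2 ^ a - 1 - r) = int a - \<sigma> r"
proof (induction a arbitrary: r)
  case (Suc a)
  show ?case
  proof (cases "even r")
    case True
    then obtain t where t: "r = 2 * t" by blast
    then have "t < 2 ^ a" using Suc by simp
    then have "2 ^ Suc a - 1 - r = 2 * (2 ^ a - 1 - t) + 1" using t by simp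
    then have "\<sigma> (2 ^ Suc a - 1 - r) = \<sigma> (2 ^ a - 1 - t) + 1"
      by (simp only: digit_sum_double_Suc')
    then show ?thesis using Suc.IH[OF \<open>t < 2 ^ a\<close>] t by simp
  next
    case False
    then obtain t where t: "r = 2 * t + 1" by (rule oddE)
    then have "t < 2 ^ a" using Suc by simp
    then have "2 ^ Suc a - 1 - r = 2 * (2 ^ a - 1 - t)" using t by simp
    then have "\<sigma> (2 ^ Suc a - 1 - r) = \<sigma> (2 ^ a - 1 - t)"
      by (simp only: digit_sum_double)
    then show ?thesis using Suc.IH[OF \<open>t < 2 ^ a\<close>] t by simp
  qed
qed simp

text \<open>Borrowing one from q leaves a low digits all equal to 1, from which r is subtracted
  without a further borrow.\<close>

lemma digit_sum_borrow:
  assumes "r < 2 ^ a" "q \<ge> 1"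
  shows "\<sigma> (2 ^ a * q - 1 - r) = \<sigma> (q - 1) + int a - \<sigma> r"
proof -
  obtain q' where q: "q = Suc q'" using assms by (cases q) auto
  have "2 ^ a * q - 1 - r = 2 ^ a * q' + (2 ^ a - 1 - r)"
    using assms q by simp
  then show ?thesis
    using digit_sum_split[of "2 ^ a - 1 - r" a q'] digit_sum_complement[OF assms(1)] assms q
    by simp
qed

section \<open>Lower bounds and exact values for the 2-adic valuation of rationals\<close>

text \<open>Rationals are needed because the two parts of the alternating sum carry the denominator
  k!. As a predicate, the bound holds for 0 at every e, so vanishing summands need no special
  treatment; \<open>val_eq\<close> excludes 0 through its odd numerator.\<close>

definition val_ge :: "int \<Rightarrow> rat \<Rightarrow> bool"
  where "val_ge e x \<longleftrightarrow> (\<exists>a b::int. odd b \<and> x * of_int b = 2 powi e * of_int a)"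

definition val_eq :: "int \<Rightarrow> rat \<Rightarrow> bool"
  where "val_eq e x \<longleftrightarrow> (\<exists>a b::int. odd a \<and> odd b \<and> x * of_int b = 2 powi e * of_int a)"

lemma val_eq_imp_ge: "val_eq e x \<Longrightarrow> val_ge e x"
  unfolding val_eq_def val_ge_def by blast

lemma val_ge_0 [simp]: "val_ge e 0"
  unfolding val_ge_def by (rule exI[of _ 0], rule exI[of _ 1]) simp

lemma val_ge_mono: "val_ge e x \<Longrightarrow> f \<le> e \<Longrightarrow> val_ge f x"
proof -
  assume "val_ge e x" "f \<le> e"
  then obtain a b where ab: "odd b" "x * of_int b = 2 powi e * of_int a"
    unfolding val_ge_def by blast
  have "2 powi e = (2::rat) powi f * 2 powi (e - f)"
    by (simp add: power_int_add[symmetric])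
  also have "(2::rat) powi (e - f) = of_int (2 ^ nat (e - f))"
    using \<open>f \<le> e\<close> by (simp add: power_int_def)
  finally have "x * of_int b = 2 powi f * of_int (2 ^ nat (e - f) * a)"
    using ab by (simp add: mult_ac)
  then show ?thesis unfolding val_ge_def using ab by blast
qed

lemma val_ge_add: "val_ge e x \<Longrightarrow> val_ge e y \<Longrightarrow> val_ge e (x + y)"
proof -
  assume "val_ge e x" "val_ge e y"
  then obtain a b a' b' where ab: "odd b" "x * of_int b = 2 powi e * of_int a"
    "odd b'" "y * of_int b' = 2 powi e * of_int a'"
    unfolding val_ge_def by blast
  have "(x + y) * of_int (b * b') = (x * of_int b) * of_int b' + (y * of_int b') * of_int b"
    by (simp add: algebra_simps)
  also have "\<dots> = 2 powi e * of_int (a * b' + a' * b)"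
    unfolding ab by (simp add: algebra_simps)
  finally show ?thesis unfolding val_ge_def using ab by (meson even_mult_iff)
qed

lemma val_ge_minus_iff [simp]: "val_ge e (- x) \<longleftrightarrow> val_ge e x"
proof -
  have "val_ge e (- x)" if "val_ge e x" for x
  proof -
    from that obtain a b where ab: "odd b" "x * of_int b = 2 powi e * of_int a"
      unfolding val_ge_def by blast
    then have "(- x) * of_int b = 2 powi e * of_int (- a)" by simp
    then show ?thesis unfolding val_ge_def using ab by blast
  qed
  from this[of x] this[of "- x"] show ?thesis by auto
qed

lemma val_ge_diff: "val_ge e x \<Longrightarrow> val_ge e y \<Longrightarrow> val_ge e (x - y)"
  using val_ge_add[of e x "- y"] by simp

lemma val_ge_sum: "(\<And>i. i \<in> I \<Longrightarrow> val_ge e (f i)) \<Longrightarrow> val_ge e (\<Sum>i\<in>I. f i)"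
  by (induction I rule: infinite_finite_induct) (auto intro: val_ge_add)

lemma val_ge_mult:
  assumes "val_ge e x" "val_ge f y"
  shows "val_ge (e + f) (x * y)"
proof -
  from assms obtain a b a' b' where ab: "odd b" "x * of_int b = 2 powi e * of_int a"
    "odd b'" "y * of_int b' = 2 powi f * of_int a'"
    unfolding val_ge_def by blast
  have "(x * y) * of_int (b * b') = (x * of_int b) * (y * of_int b')"
    by simp
  also have "\<dots> = 2 powi (e + f) * of_int (a * a')"
    unfolding ab by (simp add: power_int_add)
  finally show ?thesis unfolding val_ge_def using ab by (meson even_mult_iff)
qed

lemma val_eq_mult:
  assumes "val_eq e x" "val_eq f y"
  shows "val_eq (e + f) (x * y)"
proof -
  from assms obtain a b a' b' where ab: "odd b" "x * of_int b = 2 powi e * of_int a"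
    "odd b'" "y * of_int b' = 2 powi f * of_int a'" "odd a" "odd a'"
    unfolding val_eq_def by blast
  have "(x * y) * of_int (b * b') = (x * of_int b) * (y * of_int b')"
    by simp
  also have "\<dots> = 2 powi (e + f) * of_int (a * a')"
    unfolding ab by (simp add: power_int_add)
  finally show ?thesis unfolding val_eq_def using ab by (meson even_mult_iff)
qed

lemma val_eq_nonzero: "val_eq e x \<Longrightarrow> x \<noteq> 0"
  unfolding val_eq_def by auto

lemma val_eq_inverse: "val_eq e x \<Longrightarrow> val_eq (- e) (inverse x)"
proof -
  assume asm: "val_eq e x"
  then obtain a b where ab: "odd a" "odd b" "x * of_int b = 2 powi e * of_int a"
    unfolding val_eq_def by blast
  have "x \<noteq> 0" using asm by (rule val_eq_nonzero)
  then have "inverse x * of_int a = 2 powi (- e) * of_int b"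
    using ab(3) by (simp add: power_int_minus field_simps)
  then show ?thesis unfolding val_eq_def using ab by blast
qed

lemma val_eq_divide: "val_eq e x \<Longrightarrow> val_eq f y \<Longrightarrow> val_eq (e - f) (x / y)"
  using val_eq_mult[of e x "- f" "inverse y"] val_eq_inverse[of f y] by (simp add: divide_inverse)

lemma val_ge_divide: "val_ge e x \<Longrightarrow> val_eq f y \<Longrightarrow> val_ge (e - f) (x / y)"
  using val_ge_mult[of e x "- f" "inverse y"] val_eq_imp_ge[OF val_eq_inverse[of f y]]
  by (simp add: divide_inverse)

lemma val_eq_minus_iff [simp]: "val_eq e (- x) \<longleftrightarrow> val_eq e x"
proof -
  have "val_eq e (- x)" if "val_eq e x" for x
  proof -
    from that obtain a b where ab: "odd a" "odd b" "x * of_int b = 2 powi e * of_int a"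
      unfolding val_eq_def by blast
    then have "(- x) * of_int b = 2 powi e * of_int (- a)" by simp
    then show ?thesis unfolding val_eq_def using ab even_minus by blast
  qed
  from this[of x] this[of "- x"] show ?thesis by auto
qed

lemma val_eq_add:
  assumes "val_eq e x" "val_ge (e + 1) y"
  shows "val_eq e (x + y)"
proof -
  from assms obtain a b a' b' where ab: "odd b" "x * of_int b = 2 powi e * of_int a"
    "odd b'" "y * of_int b' = 2 powi (e + 1) * of_int a'" "odd a"
    unfolding val_eq_def val_ge_def by blast
  have "(x + y) * of_int (b * b') = (x * of_int b) * of_int b' + (y * of_int b') * of_int b"
    by (simp add: algebra_simps)
  also have "\<dots> = 2 powi e * of_int (a * b' + 2 * (a' * b))"
    unfolding ab by (simp add: algebra_simps power_int_add)
  finally show ?thesis unfolding val_eq_def using ab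
    by (metis dvd_triv_left even_add even_mult_iff)
qed

text \<open>Odd plus odd is even. Used where two minimal terms meet and, with y = -1, for a 2-adic
  unit minus 1.\<close>

lemma val_eq_add_val_eq:
  assumes "val_eq e x" "val_eq e y"
  shows "val_ge (e + 1) (x + y)"
proof -
  from assms obtain a b a' b' where ab: "odd b" "x * of_int b = 2 powi e * of_int a"
    "odd b'" "y * of_int b' = 2 powi e * of_int a'" "odd a" "odd a'"
    unfolding val_eq_def by blast
  obtain t where t: "a * b' + a' * b = 2 * t"
    using ab by (meson even_add even_mult_iff evenE)
  have "(x + y) * of_int (b * b') = (x * of_int b) * of_int b' + (y * of_int b') * of_int b"
    by (simp add: algebra_simps)
  also have "\<dots> = 2 powi e * of_int (a * b' + a' * b)"
    unfolding ab by (simp add: algebra_simps)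
  also have "\<dots> = 2 powi (e + 1) * of_int t"
    unfolding t by (simp add: power_int_add)
  finally show ?thesis unfolding val_ge_def using ab by (meson even_mult_iff)
qed

lemma val_eq_not_ge: "val_eq e x \<Longrightarrow> \<not> val_ge (e + 1) x"
proof
  assume "val_eq e x" "val_ge (e + 1) x"
  then obtain a b a' b' where ab: "odd b" "x * of_int b = 2 powi e * of_int a"
    "odd b'" "x * of_int b' = 2 powi (e + 1) * of_int a'" "odd a"
    unfolding val_eq_def val_ge_def by blast
  have "2 powi e * rat_of_int (a * b') = x * of_int b * of_int b'"
    unfolding ab by simp
  also have "\<dots> = x * of_int b' * of_int b" by simp
  also have "\<dots> = 2 powi e * rat_of_int (2 * a' * b)"
    unfolding ab by (simp add: power_int_add)
  finally have "a * b' = 2 * a' * b" by (simp only: mult_cancel_left of_int_eq_iff) simp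
  then show False using ab by (metis dvd_triv_left even_mult_iff mult.assoc)
qed

lemma val_eq_of_int: "odd a \<Longrightarrow> val_eq 0 (of_int a)"
  unfolding val_eq_def by (rule exI[of _ a], rule exI[of _ 1]) simp

lemma val_ge_of_int [simp]: "val_ge 0 (of_int a)"
  unfolding val_ge_def by (rule exI[of _ a], rule exI[of _ 1]) simp

lemma val_ge_of_nat [simp]: "val_ge 0 (of_nat a)"
  using val_ge_of_int[of "int a"] by simp

lemma val_eq_of_nat: "n > 0 \<Longrightarrow> val_eq (\<nu> n) (of_nat n)"
proof -
  assume "n > 0"
  then obtain q where q: "n = 2 ^ multiplicity 2 n * q" "\<not> 2 dvd q"
    using multiplicity_decompose'[of n 2] by auto
  then have "rat_of_nat n * of_int 1 = 2 powi (\<nu> n) * of_int (int q)"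
    by (metis mult.right_neutral of_int_1 of_int_of_nat_eq of_nat_mult of_nat_numeral of_nat_power power_int_of_nat)
  then show ?thesis unfolding val_eq_def using q(2)
    by (metis even_of_nat odd_one)
qed

lemma val_ge_of_nat_iff: "n > 0 \<Longrightarrow> val_ge e (of_nat n) \<longleftrightarrow> e \<le> \<nu> n"
  using val_eq_of_nat[of n] val_eq_not_ge[of "\<nu> n" "of_nat n"]
    val_ge_mono[of e "of_nat n" "\<nu> n + 1"] val_ge_mono[OF val_eq_imp_ge, of "\<nu> n" "of_nat n" e]
  by linarith

lemma val_eq_of_nat_iff: "n > 0 \<Longrightarrow> val_eq e (of_nat n) \<longleftrightarrow> e = \<nu> n"
  using val_eq_of_nat[of n] val_eq_not_ge[of e "of_nat n"] val_eq_imp_ge[of e "of_nat n"]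
    val_ge_of_nat_iff[of n e] val_ge_of_nat_iff[of n "e + 1"] by fastforce

lemma val_eq_2_powi: "val_eq e (2 powi e)"
  unfolding val_eq_def by (rule exI[of _ 1], rule exI[of _ 1]) simp

lemma val_eq_2_power: "val_eq (int e) (2 ^ e)"
  using val_eq_2_powi[of "int e"] by simp

lemma val_ge_mult_unit: "val_ge e x \<Longrightarrow> val_ge 0 y \<Longrightarrow> val_ge e (x * y)"
  using val_ge_mult[of e x 0 y] by simp

section \<open>Factorials and binomial coefficients (Legendre, Kummer)\<close>

lemma val_eq_fact: "val_eq (int n - \<sigma> n) (fact n)"
proof (induction n)
  case 0
  show ?case using val_eq_of_int[of 1] by simp
next
  case (Suc n)
  have "val_eq (\<nu> (Suc n) + (int n - \<sigma> n)) (of_nat (Suc n) * fact n)"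
    by (intro val_eq_mult Suc val_eq_of_nat) simp
  moreover have "\<nu> (Suc n) + (int n - \<sigma> n) = int (Suc n) - \<sigma> (Suc n)"
    using digit_sum_Suc[of n] by simp
  ultimately show ?case by simp
qed

text \<open>Kummer's theorem: the exponent counts the carries in a + b and vanishes exactly for
  carry-free additions.\<close>

lemma val_eq_binomial: "val_eq (\<sigma> a + \<sigma> b - \<sigma> (a + b)) (of_nat ((a + b) choose a))"
proof -
  have "rat_of_nat ((a + b) choose a) = fact (a + b) / (fact a * fact b)"
    using binomial_fact[of a "a + b"] by simp
  moreover have "val_eq (int (a + b) - \<sigma> (a + b) - ((int a - \<sigma> a) + (int b - \<sigma> b)))
      (fact (a + b) / (fact a * fact b))"
    by (intro val_eq_divide val_eq_mult val_eq_fact)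
  ultimately show ?thesis by (simp add: algebra_simps)
qed

lemma val_eq_binomial': "k \<le> n \<Longrightarrow> val_eq (\<sigma> k + \<sigma> (n - k) - \<sigma> n) (of_nat (n choose k))"
  using val_eq_binomial[of k "n - k"] by simp

section \<open>Lower bounds for the valuation of Stirling numbers\<close>

lemma Stirling_Suc_Suc_sum:
  "Stirling (Suc n) (Suc k) = (\<Sum>j\<le>n. (n choose j) * Stirling j k)"
proof (induction n arbitrary: k)
  case (Suc n)
  have shift: "(\<Sum>j\<le>Suc n. (Suc n choose j) * f j)
      = (\<Sum>j\<le>n. (n choose j) * f (Suc j)) + (\<Sum>j\<le>n. (n choose j) * f j)" for f :: "nat \<Rightarrow> nat"
  proof -
    have "(\<Sum>j\<le>Suc n. (Suc n choose j) * f j)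
        = f 0 + (\<Sum>j\<le>n. (n choose j) * f (Suc j)) + (\<Sum>j\<le>n. (n choose Suc j) * f (Suc j))"
      by (simp only: sum.atMost_Suc_shift) (simp add: algebra_simps sum.distrib)
    moreover have "f 0 + (\<Sum>j\<le>n. (n choose Suc j) * f (Suc j)) = (\<Sum>j\<le>Suc n. (n choose j) * f j)"
      by (simp only: sum.atMost_Suc_shift) simp
    ultimately show ?thesis by simp
  qed
  show ?case
  proof (cases k)
    case 0
    have "(\<Sum>j\<le>n. (n choose j) * Stirling j 0) = 1"
      using Suc[of 0] Stirling_1[of n] by (simp del: Stirling.simps)
    then show ?thesis unfolding 0 shift by (simp del: Stirling.simps(4))
  next
    case (Suc k')
    have "(\<Sum>j\<le>n. (n choose j) * Stirling (Suc j) (Suc k'))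
      = Suc k' * (\<Sum>j\<le>n. (n choose j) * Stirling j (Suc k')) + (\<Sum>j\<le>n. (n choose j) * Stirling j k')"
      by (simp add: algebra_simps sum.distrib sum_distrib_left)
    then show ?thesis unfolding Suc shift
      unfolding Suc.IH[symmetric] by (simp add: algebra_simps)
  qed
qed simp

text \<open>Both sides count partitions with one marked block: the j elements outside it form k
  blocks, and j < n because the marked block is nonempty.\<close>

lemma Suc_times_Stirling:
  "Suc k * Stirling n (Suc k) = (\<Sum>j<n. (n choose j) * Stirling j k)"
proof -
  have "Suc k * Stirling n (Suc k) + Stirling n k = (\<Sum>j\<le>n. (n choose j) * Stirling j k)"
    using Stirling_Suc_Suc_sum[of n k] by simp
  also have "\<dots> = (\<Sum>j<n. (n choose j) * Stirling j k) + Stirling n k"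
    by (simp add: lessThan_Suc_atMost[symmetric])
  finally show ?thesis by simp
qed

text \<open>In \<open>Suc_times_Stirling\<close> the \<sigma>(j) of the binomial coefficient cancels
  that of the induction hypothesis, \<sigma>(n - j) \<ge> 1 gains one, and division by k + 1 costs
  \<nu>(k + 1). By \<open>digit_sum_Suc\<close> these add up to \<sigma>(k + 1).\<close>

lemma val_ge_Stirling_digit_sum: "val_ge (\<sigma> k - \<sigma> n) (of_nat (Stirling n k))"
proof (induction k arbitrary: n)
  case 0
  show ?case using val_ge_of_nat[of 1] by (cases n) simp_all
next
  case (Suc k)
  have "val_ge (\<sigma> k + 1 - \<sigma> n) (\<Sum>j<n. of_nat (n choose j) * of_nat (Stirling j k))"
  proof (rule val_ge_sum)
    fix j assume "j \<in> {..<n}"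
    then have j: "j < n" by simp
    have "val_ge ((\<sigma> j + \<sigma> (n - j) - \<sigma> n) + (\<sigma> k - \<sigma> j)) (of_nat (n choose j) * of_nat (Stirling j k))"
      using j by (intro val_ge_mult Suc val_eq_imp_ge val_eq_binomial') simp
    moreover have "\<sigma> (n - j) \<ge> 1" using j by (intro digit_sum_pos) simp
    ultimately show "val_ge (\<sigma> k + 1 - \<sigma> n) (of_nat (n choose j) * of_nat (Stirling j k))"
      by (elim val_ge_mono) linarith
  qed
  also have "(\<Sum>j<n. of_nat (n choose j) * of_nat (Stirling j k)) = rat_of_nat (Suc k) * of_nat (Stirling n (Suc k))"
    unfolding of_nat_mult[symmetric] Suc_times_Stirling by simp
  finally have "val_ge (\<sigma> k + 1 - \<sigma> n - \<nu> (Suc k)) (rat_of_nat (Suc k) * of_nat (Stirling n (Suc k)) / of_nat (Suc k))"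
    by (rule val_ge_divide) (simp add: val_eq_of_nat del: of_nat_Suc)
  moreover have "\<sigma> k + 1 - \<sigma> n - \<nu> (Suc k) = \<sigma> (Suc k) - \<sigma> n"
    using digit_sum_Suc[of k] by linarith
  ultimately show ?case by (simp del: of_nat_Suc)
qed

text \<open>Comparing falling factorials in the derivative of x^(n + 1) expresses (n + 1) S(n, l)
  through S(n + 1, l + m + 1) with coefficients (-1)^m (l + m + 1)! / ((m + 1) l!). Subtracting S(n,
  l), which has the coefficients (-1)^m (l + m)! / l!, leaves n S(n, l) and creates the factor
  l.\<close>

definition log_coeff :: "nat \<Rightarrow> nat \<Rightarrow> rat"
  where "log_coeff l m = (-1) ^ m * fact (l + m) * of_nat l / (of_nat (Suc m) * fact l)"

lemma log_coeff_0: "log_coeff l 0 = of_nat l"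
  by (simp add: log_coeff_def)

lemma log_coeff_rec:
  "log_coeff (Suc l) m * of_nat (l + 2 + m) + log_coeff (Suc l) (Suc m)
    = of_nat (Suc l) * log_coeff (Suc l) m + log_coeff l (Suc m)"
  unfolding log_coeff_def
  by (simp add: divide_simps del: of_nat_Suc) (simp add: algebra_simps)

text \<open>This is the expansion \<open>D = ln (1 + \<Delta>) = \<Sum>m. (-1)^m / (m + 1) \<Delta>^(m + 1)\<close> applied to
  \<open>x ^ n\<close>; the coefficients almost contain the factor \<open>l\<close>.\<close>

lemma times_Stirling_log_expansion:
  "n \<le> M \<Longrightarrow> of_nat n * of_nat (Stirling n l) = (\<Sum>m<M. log_coeff l m * of_nat (Stirling (Suc n) (Suc (l + m))))"
proof (induction n arbitrary: l M)
  case 0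
  then show ?case by (cases l) (auto simp: log_coeff_def)
next
  case (Suc n)
  then obtain M' where M: "M = Suc M'" "n \<le> M'" by (cases M) auto
  show ?case
  proof (cases l)
    case 0
    then show ?thesis by (simp add: log_coeff_def)
  next
    case (Suc a)
    define s where "s q = rat_of_nat (Stirling (Suc n) q)" for q
    have shift: "(\<Sum>m<M. log_coeff b m * s (l + m))
        = log_coeff b 0 * s l + (\<Sum>m<M'. log_coeff b (Suc m) * s (Suc (l + m)))" for b
      unfolding M by (subst sum.lessThan_Suc_shift) simp
    \<comment> \<open>The free bound M lets the induction hypothesis be used at two lengths; the
      extra summand m = M' vanishes because l \<ge> 1 puts its lower index above n + 1.\<close>
    have top: "(\<Sum>m<M. log_coeff l m * of_nat (Suc (l + m)) * s (Suc (l + m)))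
        = (\<Sum>m<M'. log_coeff l m * of_nat (Suc (l + m)) * s (Suc (l + m)))"
      unfolding M using M(2) Suc by (simp add: s_def)
    have step: "log_coeff l m * of_nat (Suc (l + m)) + log_coeff l (Suc m) = of_nat l * log_coeff l m + log_coeff a (Suc m)" for m
    proof -
      have "Suc (l + m) = a + 2 + m" using Suc by simp
      then show ?thesis using log_coeff_rec[of a m] Suc by simp
    qed
    have "(\<Sum>m<M. log_coeff l m * of_nat (Stirling (Suc (Suc n)) (Suc (l + m))))
        = (\<Sum>m<M. log_coeff l m * of_nat (Suc (l + m)) * s (Suc (l + m))) + (\<Sum>m<M. log_coeff l m * s (l + m))"
      unfolding sum.distrib[symmetric] s_def
      by (intro sum.cong refl) (subst Stirling.simps, simp add: algebra_simps)
    also have "\<dots> = log_coeff l 0 * s l + (\<Sum>m<M'. (log_coeff l m * of_nat (Suc (l + m)) + log_coeff l (Suc m)) * s (Suc (l + m)))"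
      unfolding top shift by (simp add: algebra_simps sum.distrib)
    also have "\<dots> = log_coeff l 0 * s l + (\<Sum>m<M'. (of_nat l * log_coeff l m + log_coeff a (Suc m)) * s (Suc (l + m)))"
      using step by simp
    also have "\<dots> = of_nat l * (\<Sum>m<M'. log_coeff l m * s (Suc (l + m)))
        + (log_coeff a 0 * s l + (\<Sum>m<M'. log_coeff a (Suc m) * s (Suc (l + m)))) + s l"
      unfolding Suc by (simp add: log_coeff_0 algebra_simps sum.distrib sum_distrib_left)
    also have "\<dots> = of_nat l * (of_nat n * of_nat (Stirling n l)) + of_nat n * of_nat (Stirling n a) + s l"
      unfolding shift[symmetric] using Suc.IH[of M' l] Suc.IH[of M a] M Suc by (simp add: s_def)
    also have "\<dots> = of_nat (Suc n) * of_nat (Stirling (Suc n) l)"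
      unfolding Suc s_def by (simp add: algebra_simps)
    finally show ?thesis by simp
  qed
qed

text \<open>(l + m)! / l! is m! times a binomial coefficient, so besides l only m! / (m + 1)
  matters. Its valuation is at least -1, attained at m = 1 and m = 3.\<close>

lemma val_ge_log_coeff:
  assumes "l \<ge> 1"
  shows "val_ge (\<nu> l - 1) (log_coeff l m)"
proof -
  have "log_coeff l m = (-1) ^ m * (of_nat ((l + m) choose l) * fact m * of_nat l / of_nat (Suc m))"
  proof -
    have "fact l * fact m * ((l + m) choose l) = (fact (l + m) :: nat)"
      using binomial_fact_lemma[of l "l + m"] by simp
    then have "(fact (l + m) :: rat) = fact l * (fact m * of_nat ((l + m) choose l))"
      by (metis mult.assoc of_nat_fact of_nat_mult)
    then show ?thesis unfolding log_coeff_def by (simp del: of_nat_Suc)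
  qed
  moreover have "val_ge (0 + (int m - \<sigma> m) + \<nu> l - \<nu> (Suc m))
      (of_nat ((l + m) choose l) * fact m * of_nat l / of_nat (Suc m))"
    using assms by (intro val_ge_divide val_ge_mult val_eq_of_nat val_ge_of_nat val_eq_imp_ge[OF val_eq_fact]
        val_eq_imp_ge[OF val_eq_of_nat]) simp_all
  moreover have "\<nu> l - 1 \<le> 0 + (int m - \<sigma> m) + \<nu> l - \<nu> (Suc m)"
  proof -
    \<comment> \<open>By \<open>digit_sum_Suc\<close> and \<sigma>(m + 1) \<ge> 1, this is all the
      claim requires.\<close>
    have "2 * binary_digit_sum m \<le> Suc m"
    proof (cases "binary_digit_sum m")
      case (Suc t)
      have "Suc t \<le> 2 ^ t" by (induction t) auto
      then show ?thesis using two_power_digit_sum_le[of m] Suc by simp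
    qed simp
    moreover have "\<sigma> (Suc m) \<ge> 1" by (rule digit_sum_pos) simp
    ultimately show ?thesis using digit_sum_Suc[of m] by linarith
  qed
  ultimately have "val_ge (\<nu> l - 1) (of_nat ((l + m) choose l) * fact m * of_nat l / of_nat (Suc m))"
    by (blast intro: val_ge_mono)
  then show ?thesis
    using \<open>log_coeff l m = _\<close> by (cases "even m") simp_all
qed

text \<open>Strong when l is divisible by a much higher power of 2 than n, where the digit sum bound
  may say nothing.\<close>

lemma val_ge_Stirling_val:
  assumes "l \<ge> 1" "n \<ge> 1"
  shows "val_ge (\<nu> l - \<nu> n - 1) (of_nat (Stirling n l))"
proof -
  have "val_ge (\<nu> l - 1) (of_nat n * of_nat (Stirling n l))"
    unfolding times_Stirling_log_expansion[OF order_refl]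
    by (intro val_ge_sum val_ge_mult_unit val_ge_log_coeff assms val_ge_of_nat)
  then have "val_ge (\<nu> l - 1 - \<nu> n) (of_nat n * of_nat (Stirling n l) / of_nat n)"
    using assms by (intro val_ge_divide val_eq_of_nat) auto
  then show ?thesis using assms by (simp add: algebra_simps)
qed

lemma Stirling_Suc_self: "Stirling (Suc n) n = Suc n choose 2"
  by (induction n) (auto simp: numeral_2_eq_2)

section \<open>Binomial sums over odd and even indices\<close>

definition odd_binomial_sum :: "nat \<Rightarrow> nat \<Rightarrow> nat"
  where "odd_binomial_sum k l = (\<Sum>j\<le>k. (k choose (2 * j + 1)) * (j choose l))"

definition even_binomial_sum :: "nat \<Rightarrow> nat \<Rightarrow> nat"
  where "even_binomial_sum k l = (\<Sum>j\<le>k. (k choose (2 * j)) * (j choose l))"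

lemma odd_binomial_sum_Suc: "odd_binomial_sum (Suc k) l = odd_binomial_sum k l + even_binomial_sum k l"
  unfolding odd_binomial_sum_def even_binomial_sum_def
  by (simp add: algebra_simps sum.distrib)

lemma even_binomial_sum_Suc:
  "even_binomial_sum (Suc k) l = even_binomial_sum k l + (\<Sum>j\<le>k. (k choose (2 * j + 1)) * (Suc j choose l))"
proof -
  have "even_binomial_sum (Suc k) l = (0 choose l) + (\<Sum>j\<le>k. (Suc k choose (2 * j + 2)) * (Suc j choose l))"
    unfolding even_binomial_sum_def by (subst sum.atMost_Suc_shift) simp
  also have "\<dots> = (0 choose l) + (\<Sum>j\<le>k. (k choose (2 * Suc j)) * (Suc j choose l))
      + (\<Sum>j\<le>k. (k choose (2 * j + 1)) * (Suc j choose l))"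
    by (simp add: algebra_simps sum.distrib)
  also have "(0 choose l) + (\<Sum>j\<le>k. (k choose (2 * Suc j)) * (Suc j choose l))
      = (\<Sum>j\<le>Suc k. (k choose (2 * j)) * (j choose l))"
    by (subst sum.atMost_Suc_shift) simp
  also have "\<dots> = even_binomial_sum k l"
    unfolding even_binomial_sum_def by simp
  finally show ?thesis .
qed

lemma even_binomial_sum_Suc_Suc:
  "even_binomial_sum (Suc k) (Suc l) = odd_binomial_sum (Suc k) (Suc l) + odd_binomial_sum k l"
  unfolding even_binomial_sum_Suc odd_binomial_sum_Suc
  by (simp add: odd_binomial_sum_def algebra_simps sum.distrib)

lemma even_binomial_sum_Suc_0: "even_binomial_sum (Suc k) 0 = odd_binomial_sum (Suc k) 0"
  unfolding even_binomial_sum_Suc odd_binomial_sum_Suc by (simp add: odd_binomial_sum_def)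

lemma odd_binomial_sum_Suc_0: "odd_binomial_sum (Suc k) 0 = 2 ^ k"
proof (induction k)
  case (Suc k)
  then show ?case unfolding odd_binomial_sum_Suc[of "Suc k"] even_binomial_sum_Suc_0 by simp
qed (simp add: odd_binomial_sum_def)

lemma odd_binomial_sum_rec:
  "odd_binomial_sum (Suc (Suc k)) (Suc l) = 2 * odd_binomial_sum (Suc k) (Suc l) + odd_binomial_sum k l"
  unfolding odd_binomial_sum_Suc[of "Suc k"] even_binomial_sum_Suc_Suc by simp

text \<open>One of Moriarty's binomial identities. Up to powers of 2, the recurrence
  \<open>odd_binomial_sum_rec\<close> is Pascal's rule for the binomial coefficient on the
  right.\<close>

lemma odd_binomial_sum_closed:
  "rat_of_nat (odd_binomial_sum (Suc k) l) = 2 powi (int k - 2 * int l) * of_nat ((k - l) choose l)"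
proof (induction k arbitrary: l rule: less_induct)
  case (less k)
  show ?case
  proof (cases l)
    case 0
    then show ?thesis by (simp add: odd_binomial_sum_Suc_0)
  next
    case l: (Suc b)
    show ?thesis
    proof (cases k)
      case 0
      then show ?thesis using l by (simp add: odd_binomial_sum_def)
    next
      case k: (Suc a)
      have IH1: "rat_of_nat (odd_binomial_sum k l) = 2 powi (int a - 2 * int l) * of_nat ((a - l) choose l)"
        using less[of a l] k by simp
      have pw: "2 * 2 powi (int a - 2 * int l) = (2::rat) powi (int k - 2 * int l)"
        using power_int_add_1[of "2::rat" "int a - 2 * int l"] k by (simp add: algebra_simps)
      have rec: "odd_binomial_sum (Suc k) l = 2 * odd_binomial_sum k l + odd_binomial_sum a b"
        unfolding k l by (rule odd_binomial_sum_rec)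
      have "rat_of_nat (odd_binomial_sum a b) = 2 powi (int k - 2 * int l) * of_nat ((a - l) choose b)"
        if ba: "b < a"
      proof -
        obtain a' where a: "a = Suc a'" using ba by (cases a) auto
        have "rat_of_nat (odd_binomial_sum a b) = 2 powi (int a' - 2 * int b) * of_nat ((a' - b) choose b)"
          unfolding a using less[of a' b] k a by simp
        moreover have "int a' - 2 * int b = int k - 2 * int l" "a' - b = a - l"
          using a k l by auto
        ultimately show ?thesis by simp
      qed
      moreover have "k - l = Suc (a - l)" if "b < a" using that k l by simp
      \<comment> \<open>Outside b < a the induction hypothesis does not yield this formula, but then
        every term vanishes.\<close>
      moreover have "odd_binomial_sum a b = 0" if "\<not> b < a"
        unfolding odd_binomial_sum_def using that
        by (intro sum.neutral) (auto simp: binomial_eq_0_iff)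
      moreover have "(k - l) choose l = 0" "(a - l) choose l = 0" if "\<not> b < a"
        using that k l by auto
      ultimately show ?thesis
        unfolding rec using IH1 pw l
        by (cases "b < a") (simp_all add: algebra_simps)
    qed
  qed
qed

text \<open>The companion identity has the factor k / (k - l) next to (k - l) choose l. Multiplying
  by l and absorbing keeps it free of division.\<close>

lemma even_binomial_sum_closed:
  assumes "k \<ge> 2" "l \<ge> 1"
  shows "rat_of_nat (l * even_binomial_sum k l)
    = 2 powi (int k - 2 * int l - 1) * of_nat k * of_nat ((k - l - 1) choose (l - 1))"
proof -
  obtain a where k: "k = Suc (Suc a)"
    using assms(1) that[of "k - 2"] by simp
  obtain b where l: "l = Suc b" using assms by (cases l) auto
  have pw: "(2::rat) powi (int a - 2 * int b) = 2 * 2 powi (int a - 2 * int b - 1)"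
    using power_int_add_1[of "2::rat" "int a - 2 * int b - 1"] by (simp add: algebra_simps)
  have "rat_of_nat (even_binomial_sum k l)
      = of_nat (odd_binomial_sum (Suc (Suc a)) (Suc b)) + of_nat (odd_binomial_sum (Suc a) b)"
    unfolding k l even_binomial_sum_Suc_Suc[of "Suc a"] by simp
  also have "\<dots> = 2 powi (int a - 2 * int b - 1) * (of_nat ((a - b) choose Suc b) + 2 * of_nat ((a - b) choose b))"
    unfolding odd_binomial_sum_closed pw by (simp add: algebra_simps)
  finally have *: "rat_of_nat (l * even_binomial_sum k l) = 2 powi (int a - 2 * int b - 1) *
      (of_nat (Suc b * ((a - b) choose Suc b)) + 2 * of_nat (Suc b) * of_nat ((a - b) choose b))"
    unfolding l by (simp add: algebra_simps)
  have "rat_of_nat (Suc b * ((a - b) choose Suc b)) + 2 * of_nat (Suc b) * of_nat ((a - b) choose b)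
      = of_nat k * of_nat ((a - b) choose b)"
  proof (cases "b \<le> a - b")
    case True
    have "Suc b * ((a - b) choose Suc b) = (a - b - b) * ((a - b) choose b)"
      by (simp only: binomial_absorption binomial_absorb_comp)
    then have "rat_of_nat (Suc b * ((a - b) choose Suc b)) = of_nat (a - b - b) * of_nat ((a - b) choose b)"
      by (simp only: of_nat_mult)
    moreover have "rat_of_nat (a - b - b) = of_nat a - 2 * of_nat b"
      using True by (simp add: of_nat_diff)
    ultimately have "rat_of_nat (Suc b * ((a - b) choose Suc b)) = (of_nat a - 2 * of_nat b) * of_nat ((a - b) choose b)"
      by (simp only:)
    then show ?thesis unfolding k by (simp only:) (simp add: algebra_simps)
  next
    case False
    then show ?thesis by (simp add: binomial_eq_0)
  qed
  then show ?thesis unfolding * using k l by (simp add: algebra_simps)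
qed

section \<open>The odd and even parts of the alternating sum for Stirling numbers\<close>

text \<open>A linear functional on arbitrary functions, since it is applied not only to powers but
  also to x^p (x^2 - 1)^r and to x f(x).\<close>

definition odd_part :: "nat \<Rightarrow> (nat \<Rightarrow> rat) \<Rightarrow> rat"
  where "odd_part k f = (\<Sum>j\<le>k. of_nat (k choose (2 * j + 1)) * f (2 * j + 1)) / fact k"

definition even_part :: "nat \<Rightarrow> (nat \<Rightarrow> rat) \<Rightarrow> rat"
  where "even_part k f = (\<Sum>j\<le>k. of_nat (k choose (2 * j)) * f (2 * j)) / fact k"

lemma odd_part_add: "odd_part k (\<lambda>x. f x + g x) = odd_part k f + odd_part k g"
  unfolding odd_part_def by (simp add: algebra_simps sum.distrib add_divide_distrib)

lemma odd_part_diff: "odd_part k (\<lambda>x. f x - g x) = odd_part k f - odd_part k g"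
  unfolding odd_part_def by (simp add: algebra_simps sum_subtractf diff_divide_distrib)

lemma odd_part_cmult: "odd_part k (\<lambda>x. c * f x) = c * odd_part k f"
  unfolding odd_part_def by (simp add: sum_distrib_left mult_ac)

lemma odd_part_sum: "odd_part k (\<lambda>x. \<Sum>i\<in>I. f i x) = (\<Sum>i\<in>I. odd_part k (f i))"
proof (induction I rule: infinite_finite_induct)
  case (insert i I)
  then show ?case by (simp add: odd_part_add)
qed (simp_all add: odd_part_def)

lemma odd_part_cong: "(\<And>j. f (2 * j + 1) = g (2 * j + 1)) \<Longrightarrow> odd_part k f = odd_part k g"
  unfolding odd_part_def by simp

lemma times_binomial_Suc:
  "of_nat x * rat_of_nat (Suc k choose x) = of_nat (Suc k) * (of_nat (Suc k choose x) - of_nat (k choose x))"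
proof (cases x)
  case (Suc y)
  have "Suc y * (Suc k choose Suc y) = Suc k * (k choose y)"
    using Suc_times_binomial_eq[of k y] by (simp only: mult.commute)
  then have "rat_of_nat (Suc y) * of_nat (Suc k choose Suc y) = of_nat (Suc k) * of_nat (k choose y)"
    by (metis of_nat_mult)
  then show ?thesis unfolding Suc by (simp add: algebra_simps)
qed simp

text \<open>Multiplication by x acts on the functionals like the Stirling recurrence, with the sign
  (-1)^k built in. It yields \<open>even_part_minus_odd_part\<close> and later allows a factor x to
  be traded for a change of k.\<close>

lemma odd_part_times:
  "odd_part (Suc k) (\<lambda>x. of_nat x * f x) = of_nat (Suc k) * odd_part (Suc k) f - odd_part k f"
proof -
  have "(\<Sum>j\<le>Suc k. of_nat (Suc k choose (2 * j + 1)) * (of_nat (2 * j + 1) * f (2 * j + 1)))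
      = (\<Sum>j\<le>Suc k. of_nat (Suc k) * (of_nat (Suc k choose (2 * j + 1)) - of_nat (k choose (2 * j + 1))) * f (2 * j + 1))"
    using times_binomial_Suc[of "2 * j + 1" k for j] by (intro sum.cong refl) (simp add: mult_ac del: of_nat_Suc binomial_Suc_Suc)
  also have "\<dots> = of_nat (Suc k) * ((\<Sum>j\<le>Suc k. of_nat (Suc k choose (2 * j + 1)) * f (2 * j + 1))
      - (\<Sum>j\<le>Suc k. of_nat (k choose (2 * j + 1)) * f (2 * j + 1)))"
    by (simp only: sum_distrib_left right_diff_distrib left_diff_distrib sum_subtractf mult.assoc)
  also have "(\<Sum>j\<le>Suc k. of_nat (k choose (2 * j + 1)) * f (2 * j + 1))
      = (\<Sum>j\<le>k. of_nat (k choose (2 * j + 1)) * f (2 * j + 1))"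
    by (simp add: binomial_eq_0)
  finally show ?thesis
    unfolding odd_part_def by (simp add: diff_divide_distrib right_diff_distrib del: of_nat_Suc sum.atMost_Suc binomial_Suc_Suc)
qed

lemma even_part_times:
  "even_part (Suc k) (\<lambda>x. of_nat x * f x) = of_nat (Suc k) * even_part (Suc k) f - even_part k f"
proof -
  have "(\<Sum>j\<le>Suc k. of_nat (Suc k choose (2 * j)) * (of_nat (2 * j) * f (2 * j)))
      = (\<Sum>j\<le>Suc k. of_nat (Suc k) * (of_nat (Suc k choose (2 * j)) - of_nat (k choose (2 * j))) * f (2 * j))"
    using times_binomial_Suc[of "2 * j" k for j] by (intro sum.cong refl) (simp add: mult_ac del: of_nat_Suc binomial_Suc_Suc)
  also have "\<dots> = of_nat (Suc k) * ((\<Sum>j\<le>Suc k. of_nat (Suc k choose (2 * j)) * f (2 * j))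
      - (\<Sum>j\<le>Suc k. of_nat (k choose (2 * j)) * f (2 * j)))"
    by (simp only: sum_distrib_left right_diff_distrib left_diff_distrib sum_subtractf mult.assoc)
  also have "(\<Sum>j\<le>Suc k. of_nat (k choose (2 * j)) * f (2 * j))
      = (\<Sum>j\<le>k. of_nat (k choose (2 * j)) * f (2 * j))"
    by (simp add: binomial_eq_0)
  finally show ?thesis
    unfolding even_part_def by (simp add: diff_divide_distrib right_diff_distrib del: of_nat_Suc sum.atMost_Suc binomial_Suc_Suc)
qed

lemma odd_part_one: "k \<ge> 1 \<Longrightarrow> odd_part k (\<lambda>x. 1) = 2 ^ (k - 1) / fact k"
proof -
  assume "k \<ge> 1"
  then obtain a where k: "k = Suc a" by (cases k) auto
  have "(\<Sum>j\<le>k. rat_of_nat (k choose (2 * j + 1))) = of_nat (odd_binomial_sum (Suc a) 0)"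
    unfolding odd_binomial_sum_def k by simp
  then show ?thesis unfolding odd_part_def k odd_binomial_sum_Suc_0 by simp
qed

lemma even_part_one: "k \<ge> 1 \<Longrightarrow> even_part k (\<lambda>x. 1) = odd_part k (\<lambda>x. 1)"
proof -
  assume "k \<ge> 1"
  then obtain a where k: "k = Suc a" by (cases k) auto
  have "(\<Sum>j\<le>k. rat_of_nat (k choose (2 * j + 1))) = of_nat (odd_binomial_sum (Suc a) 0)"
    "(\<Sum>j\<le>k. rat_of_nat (k choose (2 * j))) = of_nat (even_binomial_sum (Suc a) 0)"
    unfolding odd_binomial_sum_def even_binomial_sum_def k by simp_all
  then show ?thesis unfolding odd_part_def even_part_def even_binomial_sum_Suc_0 by simp
qed

lemma even_part_minus_odd_part:
  "even_part k (\<lambda>x. of_nat x ^ n) - odd_part k (\<lambda>x. of_nat x ^ n) = (-1) ^ k * of_nat (Stirling n k)"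
proof (induction n arbitrary: k)
  case 0
  show ?case
  proof (cases k)
    case 0
    then show ?thesis by (simp add: even_part_def odd_part_def)
  next
    case (Suc a)
    then show ?thesis using even_part_one[of k] by simp
  qed
next
  case (Suc n)
  show ?case
  proof (cases k)
    case 0
    then show ?thesis by (simp add: even_part_def odd_part_def)
  next
    case k: (Suc a)
    have "even_part k (\<lambda>x. of_nat x ^ Suc n) - odd_part k (\<lambda>x. of_nat x ^ Suc n)
      = of_nat k * (even_part k (\<lambda>x. of_nat x ^ n) - odd_part k (\<lambda>x. of_nat x ^ n))
        - (even_part a (\<lambda>x. of_nat x ^ n) - odd_part a (\<lambda>x. of_nat x ^ n))"
      unfolding k power_Suc odd_part_times even_part_times by (simp add: algebra_simps)
    then show ?thesis unfolding Suc.IH k by (simp add: algebra_simps)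
  qed
qed

section \<open>The even part of a power as a sum over Stirling numbers\<close>

lemma power_eq_sum_Stirling:
  "rat_of_nat x ^ n = (\<Sum>l\<le>n. of_nat (Stirling n l) * fact l * of_nat (x choose l))"
proof (induction n)
  case (Suc n)
  have step: "rat_of_nat x * (fact l * of_nat (x choose l))
      = fact (Suc l) * of_nat (x choose Suc l) + of_nat l * (fact l * of_nat (x choose l))" for l
  proof (cases "l \<le> x")
    case True
    have "Suc l * (x choose Suc l) = (x - l) * (x choose l)"
      by (simp only: binomial_absorption binomial_absorb_comp)
    then have "rat_of_nat (Suc l) * of_nat (x choose Suc l) = (of_nat x - of_nat l) * of_nat (x choose l)"
      using True by (metis of_nat_diff of_nat_mult)
    then have eq: "rat_of_nat x * of_nat (x choose l) = of_nat (Suc l) * of_nat (x choose Suc l) + of_nat l * of_nat (x choose l)"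
      by (simp add: algebra_simps)
    have "rat_of_nat x * (fact l * of_nat (x choose l)) = fact l * (rat_of_nat x * of_nat (x choose l))"
      by simp
    then show ?thesis unfolding eq by (simp add: algebra_simps)
  next
    case False
    then show ?thesis by (simp add: binomial_eq_0)
  qed
  have "rat_of_nat x ^ Suc n = (\<Sum>l\<le>n. of_nat (Stirling n l) * (rat_of_nat x * (fact l * of_nat (x choose l))))"
    by (simp add: Suc sum_distrib_left mult_ac)
  also have "\<dots> = (\<Sum>l\<le>n. of_nat (Stirling n l) * (fact (Suc l) * of_nat (x choose Suc l)))
      + (\<Sum>l\<le>n. of_nat (Stirling n l) * of_nat l * (fact l * of_nat (x choose l)))"
    unfolding step by (simp only: distrib_left sum.distrib mult.assoc)
  also have "(\<Sum>l\<le>n. of_nat (Stirling n l) * of_nat l * (fact l * of_nat (x choose l)))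
      = (\<Sum>l\<le>Suc n. of_nat (Stirling n l) * of_nat l * (fact l * rat_of_nat (x choose l)))"
    by simp
  also have "\<dots> = (\<Sum>l\<le>n. of_nat (Stirling n (Suc l)) * of_nat (Suc l) * (fact (Suc l) * rat_of_nat (x choose Suc l)))"
    by (subst sum.atMost_Suc_shift) simp
  also have "(\<Sum>l\<le>n. of_nat (Stirling n l) * (fact (Suc l) * of_nat (x choose Suc l))) + \<dots>
      = (\<Sum>l\<le>n. of_nat (Stirling (Suc n) (Suc l)) * fact (Suc l) * of_nat (x choose Suc l))"
    unfolding sum.distrib[symmetric] by (intro sum.cong refl) (simp add: algebra_simps)
  also have "\<dots> = (\<Sum>l\<le>Suc n. of_nat (Stirling (Suc n) l) * fact l * of_nat (x choose l))"
    by (subst sum.atMost_Suc_shift) simp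
  finally show ?case .
qed simp

text \<open>For l \<ge> 1 this is 2^n l! \<open>even_binomial_sum k l\<close> / k! with the closed
  form inserted; expanding j^n in the binomials j choose l turns (2j)^n into such terms.\<close>

definition even_coeff :: "nat \<Rightarrow> nat \<Rightarrow> nat \<Rightarrow> rat"
  where "even_coeff k n l = 2 powi (int k + int n - 2 * int l - 1) * of_nat k
    * (fact (l - 1) * of_nat ((k - l - 1) choose (l - 1))) / fact k"

lemma even_part_power:
  assumes "k \<ge> 2" "n \<ge> 1"
  shows "even_part k (\<lambda>x. of_nat x ^ n) = (\<Sum>l=1..n. of_nat (Stirling n l) * even_coeff k n l)"
proof -
  have "(\<Sum>j\<le>k. of_nat (k choose (2 * j)) * rat_of_nat (2 * j) ^ n)
      = (\<Sum>j\<le>k. \<Sum>l\<le>n. of_nat (Stirling n l) * (2 ^ n * fact l * (of_nat (k choose (2 * j)) * of_nat (j choose l))))"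
    by (simp add: power_mult_distrib power_eq_sum_Stirling[of _ n] sum_distrib_left mult_ac)
  also have "\<dots> = (\<Sum>l\<le>n. of_nat (Stirling n l) * (2 ^ n * fact l * of_nat (even_binomial_sum k l)))"
    by (subst sum.swap) (simp add: sum_distrib_left even_binomial_sum_def)
  \<comment> \<open>n \<ge> 1 gives S(n, 0) = 0, so the index l = 0, where the closed form does not
    apply, drops out.\<close>
  also have "\<dots> = (\<Sum>l\<in>{1..n}. of_nat (Stirling n l) * (2 ^ n * fact l * of_nat (even_binomial_sum k l)))"
  proof (rule sum.mono_neutral_right)
    show "\<forall>l\<in>{..n} - {1..n}. rat_of_nat (Stirling n l) * (2 ^ n * fact l * of_nat (even_binomial_sum k l)) = 0"
    proof
      fix l assume "l \<in> {..n} - {1..n}"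
      then have "l = 0" by auto
      then show "rat_of_nat (Stirling n l) * (2 ^ n * fact l * of_nat (even_binomial_sum k l)) = 0"
        using assms by (cases n) auto
    qed
  qed auto
  also have "\<dots> / fact k = (\<Sum>l\<in>{1..n}. of_nat (Stirling n l) * even_coeff k n l)"
    unfolding sum_divide_distrib
  proof (intro sum.cong refl)
    fix l assume l: "l \<in> {1..n}"
    have "(2::rat) ^ n * fact l * of_nat (even_binomial_sum k l) = 2 ^ n * fact (l - 1) * of_nat (l * even_binomial_sum k l)"
      using l fact_reduce[of l, where 'a = rat] by simp
    also have "\<dots> = 2 powi (int k + int n - 2 * int l - 1) * of_nat k
        * (fact (l - 1) * of_nat ((k - l - 1) choose (l - 1)))"
    proof -
      have "(2::rat) powi (int k + int n - 2 * int l - 1) = 2 ^ n * 2 powi (int k - 2 * int l - 1)"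
        using power_int_add[of "2::rat" "int n" "int k - 2 * int l - 1"] by (simp add: algebra_simps)
      then show ?thesis using l assms by (subst even_binomial_sum_closed) auto
    qed
    finally show "of_nat (Stirling n l) * (2 ^ n * fact l * of_nat (even_binomial_sum k l)) / fact k
        = of_nat (Stirling n l) * even_coeff k n l"
      unfolding even_coeff_def by simp
  qed
  finally show ?thesis unfolding even_part_def by simp
qed

lemma even_coeff_eq_0: "k \<ge> 2 \<Longrightarrow> k < 2 * l \<Longrightarrow> even_coeff k n l = 0"
  unfolding even_coeff_def by (simp add: binomial_eq_0)

text \<open>(l - 1)! times the binomial coefficient is (k - l - 1)! / (k - 2l)!, so Legendre's
  formula gives an exact value.\<close>

lemma val_eq_even_coeff:
  assumes "l \<ge> 1" "2 * l \<le> k"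
  shows "val_eq (int n - int l - 2 + \<nu> k + \<sigma> k + \<sigma> (k - 2 * l) - \<sigma> (k - l - 1)) (even_coeff k n l)"
proof -
  have "fact (l - 1) * rat_of_nat ((k - l - 1) choose (l - 1)) = fact (k - l - 1) / fact (k - 2 * l)"
    using assms binomial_fact[of "l - 1" "k - l - 1", where 'a = rat] by (simp add: mult_2)
  then have "even_coeff k n l = 2 powi (int k + int n - 2 * int l - 1) * of_nat k * (fact (k - l - 1) / fact (k - 2 * l)) / fact k"
    unfolding even_coeff_def by simp
  moreover have "val_eq ((int k + int n - 2 * int l - 1) + \<nu> k + ((int (k - l - 1) - \<sigma> (k - l - 1))
      - (int (k - 2 * l) - \<sigma> (k - 2 * l))) - (int k - \<sigma> k)) \<dots>"
    using assms by (intro val_eq_divide val_eq_mult val_eq_2_powi val_eq_of_nat val_eq_fact) auto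
  moreover have "int (k - l - 1) = int k - int l - 1" "int (k - 2 * l) = int k - 2 * int l"
    using assms by auto
  ultimately show ?thesis by (simp add: algebra_simps)
qed

text \<open>At x = 2j + 1 the argument is j, so \<open>odd_binomial_sum\<close> applies. The loss of
  k is affordable because (x^2 - 1)^K contributes 4^K = 2^k.\<close>

lemma val_ge_odd_part_power:
  assumes "k = 2 * K" "K \<ge> 1"
  shows "val_ge (\<sigma> k - 1 + \<nu> k - int k) (odd_part k (\<lambda>x. of_nat ((x - 1) div 2) ^ s))"
proof -
  obtain a where a: "k = Suc a" using assms that[of "k - 1"] by simp
  have "(\<Sum>j\<le>k. of_nat (k choose (2 * j + 1)) * rat_of_nat j ^ s)
      = (\<Sum>j\<le>k. \<Sum>l\<le>s. of_nat (Stirling s l) * (fact l * (of_nat (k choose (2 * j + 1)) * of_nat (j choose l))))"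
    by (simp add: power_eq_sum_Stirling[of _ s] sum_distrib_left mult_ac)
  also have "\<dots> = (\<Sum>l\<le>s. of_nat (Stirling s l) * (fact l * of_nat (odd_binomial_sum k l)))"
    by (subst sum.swap) (simp add: sum_distrib_left odd_binomial_sum_def)
  finally have eq: "odd_part k (\<lambda>x. of_nat ((x - 1) div 2) ^ s)
      = (\<Sum>l\<le>s. of_nat (Stirling s l) * (fact l * of_nat (odd_binomial_sum k l) / fact k))"
    unfolding odd_part_def by (simp add: sum_divide_distrib)
  show ?thesis unfolding eq
  proof (intro val_ge_sum)
    fix l
    have closed: "rat_of_nat (odd_binomial_sum k l) = 2 powi (int a - 2 * int l) * of_nat ((a - l) choose l)"
      unfolding a by (rule odd_binomial_sum_closed)
    have "val_ge (\<sigma> k - 1 + \<nu> k - int k) (fact l * of_nat (odd_binomial_sum k l) / fact k)"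
    proof (cases "l < K")
      case True
      have "val_ge ((int l - \<sigma> l) + ((int a - 2 * int l) + 0) - (int k - \<sigma> k)) (fact l * of_nat (odd_binomial_sum k l) / fact k)"
        unfolding closed
        by (intro val_ge_divide val_ge_mult val_eq_fact val_eq_imp_ge[OF val_eq_fact] val_eq_imp_ge[OF val_eq_2_powi] val_ge_of_nat)
      moreover have "\<sigma> k - 1 + \<nu> k - int k \<le> (int l - \<sigma> l) + ((int a - 2 * int l) + 0) - (int k - \<sigma> k)"
      proof -
        \<comment> \<open>With l < K the claim reduces to \<sigma>(l) + \<nu>(K) \<le> K, and each
          summand is at most K / 2.\<close>
        have dbl: "2 * t \<le> 2 ^ t" if "t \<ge> 1" for t :: nat
          using that by (induction t rule: dec_induct) auto
        have "2 ^ binary_digit_sum l \<le> K"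
          using two_power_digit_sum_le[of l] True by linarith
        then have "2 * binary_digit_sum l \<le> K"
          using dbl[of "binary_digit_sum l"] by (cases "binary_digit_sum l = 0") auto
        moreover have "2 ^ multiplicity 2 K \<le> K"
          using assms by (intro dvd_imp_le multiplicity_dvd) auto
        then have "2 * multiplicity 2 K \<le> K"
          using dbl[of "multiplicity 2 K"] by (cases "multiplicity 2 K = 0") auto
        moreover have "multiplicity 2 k = Suc (multiplicity 2 K)"
          unfolding assms(1) using assms(2) by (intro multiplicity_two_double) simp
        ultimately show ?thesis using True a assms by linarith
      qed
      ultimately show ?thesis by (rule val_ge_mono)
    next
      case False
      then have "a - l < l" using a assms by auto
      then show ?thesis unfolding closed by (simp add: binomial_eq_0)
    qed
    then show "val_ge (\<sigma> k - 1 + \<nu> k - int k) (of_nat (Stirling s l) * (fact l * of_nat (odd_binomial_sum k l) / fact k))"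
      using val_ge_mult[of 0 "of_nat (Stirling s l)"] by fastforce
  qed
qed

lemma val_ge_odd_part_poly:
  fixes p :: "int poly"
  assumes "k = 2 * K" "K \<ge> 1"
  shows "val_ge (\<sigma> k - 1 + \<nu> k - int k) (odd_part k (\<lambda>x. of_int (poly p (int ((x - 1) div 2)))))"
proof -
  have "odd_part k (\<lambda>x. of_int (poly p (int ((x - 1) div 2))))
      = (\<Sum>s\<le>degree p. of_int (coeff p s) * odd_part k (\<lambda>x. of_nat ((x - 1) div 2) ^ s))"
    unfolding poly_altdef odd_part_cmult[symmetric] odd_part_sum[symmetric] by simp
  also have "val_ge (0 + (\<sigma> k - 1 + \<nu> k - int k)) \<dots>"
    by (intro val_ge_sum val_ge_mult val_ge_of_int val_ge_odd_part_power[OF assms])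
  finally show ?thesis by simp
qed

lemma val_ge_odd_part_high:
  assumes "k = 2 * K" "K \<ge> 1" "r \<ge> K"
  shows "val_ge (\<sigma> k - 1 + \<nu> k) (odd_part k (\<lambda>x. of_nat x ^ p * (of_nat x ^ 2 - 1) ^ r))"
proof -
  \<comment> \<open>For x = 2j + 1, x^2 - 1 = 4j(j + 1). Of the r factors 4, K give 2^k and the
    others stay in P.\<close>
  define P :: "int poly" where "P = [:1, 2:] ^ p * ([:0, 1:] * [:1, 1:]) ^ r * [:4:] ^ (r - K)"
  have "odd_part k (\<lambda>x. of_nat x ^ p * (of_nat x ^ 2 - 1) ^ r)
      = odd_part k (\<lambda>x. 2 ^ k * of_int (poly P (int ((x - 1) div 2))))"
  proof (rule odd_part_cong)
    fix j
    have sq: "(rat_of_nat (2 * j + 1))\<^sup>2 - 1 = 4 * (of_nat j * (of_nat j + 1))"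
      by (simp add: power2_eq_square algebra_simps)
    have four: "(4::rat) ^ r = 2 ^ k * 4 ^ (r - K)"
      using assms by (simp add: power_mult power_add[symmetric] del: power_add)
    show "of_nat (2 * j + 1) ^ p * ((of_nat (2 * j + 1))\<^sup>2 - 1) ^ r
        = 2 ^ k * rat_of_int (poly P (int ((2 * j + 1 - 1) div 2)))"
      unfolding sq power_mult_distrib four P_def by (simp add: power_mult_distrib algebra_simps)
  qed
  also have "val_ge (int k + (\<sigma> k - 1 + \<nu> k - int k)) \<dots>"
    unfolding odd_part_cmult
    by (intro val_ge_mult val_eq_imp_ge[OF val_eq_2_power] val_ge_odd_part_poly[OF assms(1,2)])
  finally show ?thesis by (rule val_ge_mono) simp
qed

section \<open>Valuation of the even part\<close>

lemma digit_sum_add_disjoint: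
  assumes "e < 2 ^ multiplicity 2 l"
  shows "\<sigma> (l + e) = \<sigma> l + \<sigma> e"
proof -
  define a where "a = multiplicity 2 l"
  have "2 ^ a dvd l" unfolding a_def by (rule multiplicity_dvd)
  then obtain q where q: "l = 2 ^ a * q" by (elim dvdE)
  have "e < 2 ^ a" using assms unfolding a_def .
  then show ?thesis unfolding q by (simp add: digit_sum_split)
qed

lemma val_ge_even_term:
  assumes "l \<ge> 1" "2 * l \<le> k" "val_ge s (of_nat (Stirling n l))"
    "e \<le> s + int n - int l - 2 + \<nu> k + \<sigma> k + \<sigma> (k - 2 * l) - \<sigma> (k - l - 1)"
  shows "val_ge e (of_nat (Stirling n l) * even_coeff k n l)"
  using val_ge_mult[OF assms(3) val_eq_imp_ge[OF val_eq_even_coeff[OF assms(1,2), of n]]] assms(4)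
  by (auto elim: val_ge_mono)

text \<open>Subadditivity estimates for the digit sums of \<open>val_eq_even_coeff\<close> at k =
  2K. The index i is the exponent m halved and rounded down, and e is the distance from r, half of
  l, to i.\<close>

lemma digit_sum_gap_even:
  assumes "l = 2 * r" "1 \<le> r" "l \<le> K" "i = r + e" "i < K"
  shows "\<sigma> (2 * K - l - 1) \<le> \<sigma> (K - 1 - i) + \<sigma> e + 1"
    and "\<sigma> (2 * K - 2 * l) = \<sigma> (K - l)"
    and "\<sigma> (K - 1) \<le> \<sigma> (K - l) + \<sigma> r + \<nu> r"
    and "\<sigma> K \<le> \<sigma> (K - l) + \<sigma> r"
proof -
  have "2 * K - l - 1 = 2 * (K - 1 - r) + 1" using assms by auto
  then have "\<sigma> (2 * K - l - 1) = \<sigma> (K - 1 - r) + 1" by (simp only: digit_sum_double_Suc')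
  moreover have "K - 1 - r = (K - 1 - i) + e" using assms by auto
  ultimately show "\<sigma> (2 * K - l - 1) \<le> \<sigma> (K - 1 - i) + \<sigma> e + 1"
    using digit_sum_add_le[of "K - 1 - i" e] by simp
  show "\<sigma> (2 * K - 2 * l) = \<sigma> (K - l)"
    using digit_sum_double[of "K - l"] by (simp add: diff_mult_distrib2)
  have "K - 1 = (K - l) + (2 * (r - 1) + 1)" using assms by auto
  then have "\<sigma> (K - 1) \<le> \<sigma> (K - l) + (\<sigma> (r - 1) + 1)"
    using digit_sum_add_le[of "K - l" "2 * (r - 1) + 1"] unfolding digit_sum_double_Suc' by simp
  then show "\<sigma> (K - 1) \<le> \<sigma> (K - l) + \<sigma> r + \<nu> r"
    using digit_sum_pred[OF assms(2)] by simp
  show "\<sigma> K \<le> \<sigma> (K - l) + \<sigma> r"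
    using digit_sum_diff_le[OF assms(3)] assms(1) by simp
qed

lemma digit_sum_gap_odd:
  assumes "l = 2 * r + 1" "l \<le> K" "i = r + e" "i < K"
  shows "\<sigma> (2 * K - l - 1) \<le> \<sigma> (K - 1 - i) + \<sigma> e"
    and "\<sigma> (2 * K - 2 * l) = \<sigma> (K - l)"
    and "\<sigma> (K - 1) \<le> \<sigma> (K - l) + \<sigma> r"
proof -
  have "2 * K - l - 1 = 2 * (K - 1 - r)" using assms by auto
  then have "\<sigma> (2 * K - l - 1) = \<sigma> (K - 1 - r)" by (simp only: digit_sum_double)
  moreover have "K - 1 - r = (K - 1 - i) + e" using assms by auto
  ultimately show "\<sigma> (2 * K - l - 1) \<le> \<sigma> (K - 1 - i) + \<sigma> e"
    using digit_sum_add_le[of "K - 1 - i" e] by simp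
  show "\<sigma> (2 * K - 2 * l) = \<sigma> (K - l)"
    using digit_sum_double[of "K - l"] by (simp add: diff_mult_distrib2)
  have "K - 1 = (K - l) + 2 * r" using assms by auto
  then show "\<sigma> (K - 1) \<le> \<sigma> (K - l) + \<sigma> r"
    using digit_sum_add_le[of "K - l" "2 * r"] by simp
qed

lemma two_power_le_imp: "2 ^ a \<le> (e::nat) \<Longrightarrow> int a + 1 \<le> int e"
  using less_exp[of a] by linarith

text \<open>X is the surplus of summand l of E(m) over the bound of
  \<open>val_ge_even_part_power\<close>, before S(m, l) is counted. Let l = 2r and i = r + e. If e <
  2^\<nu>(r), then r + e is carry-free and the \<nu>-bound suffices (for e = 0, the digit sum
  bound). Otherwise e > \<nu>(r), and the digit sum bound suffices, as it does for odd l.\<close>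

lemma Stirling_bounds_suffice_even:
  assumes "m = 2 * i" "1 \<le> i" "i < K" "1 \<le> l" "l \<le> m" "l \<le> K"
    and X: "X = int m - int l + \<sigma> (2 * K - 2 * l) - \<sigma> (2 * K - l - 1) + \<nu> m
      + (\<sigma> i + \<sigma> (K - 1 - i) - \<sigma> (K - 1))"
  shows "0 \<le> X + (\<sigma> l - \<sigma> m) \<or> 0 \<le> X + (\<nu> l - \<nu> m - 1)"
proof -
  have m: "\<nu> m = \<nu> i + 1" "\<sigma> m = \<sigma> i"
    using assms(1,2) by (simp_all add: multiplicity_two_double)
  show ?thesis
  proof (cases "even l")
    case True
    then obtain r where r: "l = 2 * r" by blast
    then have r1: "1 \<le> r" using assms by simp
    obtain e where e: "i = r + e" using assms r le_Suc_ex[of r i] by auto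
    note gap = digit_sum_gap_even[OF r r1 assms(6) e assms(3)]
    have l: "\<nu> l = \<nu> r + 1" "\<sigma> l = \<sigma> r"
      using r r1 by (simp_all add: multiplicity_two_double)
    have ml: "int m - int l = 2 * int e" using assms r e by simp
    have "X \<ge> 2 * int e - \<sigma> e + \<nu> i + \<sigma> i - \<sigma> r - \<nu> r"
      unfolding X m ml using gap by linarith
    then have A: "X + (\<sigma> l - \<sigma> m) \<ge> 2 * int e - \<sigma> e + \<nu> i - \<nu> r"
      and B: "X + (\<nu> l - \<nu> m - 1) \<ge> 2 * int e - \<sigma> e + \<sigma> i - \<sigma> r - 1"
      unfolding l m by linarith+
    show ?thesis
    proof (cases "e < 2 ^ multiplicity 2 r")
      case True
      then have "\<sigma> i = \<sigma> r + \<sigma> e" unfolding e by (rule digit_sum_add_disjoint)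
      then show ?thesis using A B e by (cases "e = 0") auto
    next
      case False
      then show ?thesis using A two_power_le_imp[of "multiplicity 2 r" e] digit_sum_le[of e] by simp
    qed
  next
    case False
    then obtain r where r: "l = 2 * r + 1" by (rule oddE)
    obtain e where e: "i = r + e" "e \<ge> 1" using assms r le_Suc_ex[of r i] by auto
    note gap = digit_sum_gap_odd[OF r assms(6) e(1) assms(3)]
    have l: "\<sigma> l = \<sigma> r + 1" unfolding r by simp
    have ml: "int m - int l = 2 * int e - 1" using assms r e by simp
    have "X + (\<sigma> l - \<sigma> m) \<ge> 2 * int e - \<sigma> e + \<nu> i + 1"
      unfolding X m ml l using gap by linarith
    then show ?thesis using digit_sum_le[of e] by linarith
  qed
qed

lemma Stirling_bounds_suffice_odd:
  assumes "m = 2 * i + 1" "i < K" "1 \<le> l" "l \<le> m" "l \<le> K"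
    and X: "X = int m - int l + \<sigma> (2 * K - 2 * l) - \<sigma> (2 * K - l - 1)
      + (\<sigma> i + \<sigma> (K - 1 - i) - \<sigma> (K - 1))"
  shows "0 \<le> X + (\<sigma> l - \<sigma> m) \<or> 0 \<le> X + (\<nu> l - \<nu> m - 1)"
proof -
  have m: "\<nu> m = 0" "\<sigma> m = \<sigma> i + 1"
    using assms(1) by (simp_all add: multiplicity_two_odd)
  show ?thesis
  proof (cases "even l")
    case True
    then obtain r where r: "l = 2 * r" by blast
    then have r1: "1 \<le> r" using assms by simp
    obtain e where e: "i = r + e" using assms r le_Suc_ex[of r i] by auto
    note gap = digit_sum_gap_even[OF r r1 assms(5) e assms(2)]
    have l: "\<nu> l = \<nu> r + 1" "\<sigma> l = \<sigma> r"
      using r r1 by (simp_all add: multiplicity_two_double)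
    have ml: "int m - int l = 2 * int e + 1" using assms r e by simp
    have "X \<ge> 2 * int e - \<sigma> e + \<sigma> i - \<sigma> r - \<nu> r"
      unfolding X ml using gap by linarith
    then have A: "X + (\<sigma> l - \<sigma> m) \<ge> 2 * int e - \<sigma> e - 1 - \<nu> r"
      and B: "X + (\<nu> l - \<nu> m - 1) \<ge> 2 * int e - \<sigma> e + \<sigma> i - \<sigma> r"
      unfolding l m by linarith+
    show ?thesis
    proof (cases "e < 2 ^ multiplicity 2 r")
      case True
      then have "\<sigma> i = \<sigma> r + \<sigma> e" unfolding e by (rule digit_sum_add_disjoint)
      then show ?thesis using B by linarith
    next
      case False
      then show ?thesis using A two_power_le_imp[of "multiplicity 2 r" e] digit_sum_le[of e] by simp
    qed
  next
    case False
    then obtain r where r: "l = 2 * r + 1" by (rule oddE)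
    obtain e where e: "i = r + e" using assms r le_Suc_ex[of r i] by auto
    note gap = digit_sum_gap_odd[OF r assms(5) e assms(2)]
    have l: "\<sigma> l = \<sigma> r + 1" unfolding r by simp
    have ml: "int m - int l = 2 * int e" using assms r e by simp
    have "X + (\<sigma> l - \<sigma> m) \<ge> 2 * int e - \<sigma> e"
      unfolding X m ml l using gap by linarith
    then show ?thesis using digit_sum_le[of e] by linarith
  qed
qed

lemma odd_part_power_eq_even_part:
  "m < k \<Longrightarrow> odd_part k (\<lambda>x. of_nat x ^ m) = even_part k (\<lambda>x. of_nat x ^ m)"
  using even_part_minus_odd_part[of k m] by simp

text \<open>The subtracted \<sigma>(i) + \<sigma>(K - 1 - i) - \<sigma>(K - 1) is the valuation of
  \<open>(K - 1) choose i\<close>, which the interpolation coefficient at node i gives back.\<close>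

lemma val_ge_even_part_power:
  assumes k: "k = 2 * K" and m: "1 \<le> m" "m < k" and i: "i = m div 2"
    and e: "e = \<nu> k + \<sigma> k - 2 - \<nu> m - (\<sigma> i + \<sigma> (K - 1 - i) - \<sigma> (K - 1))"
  shows "val_ge e (even_part k (\<lambda>x. of_nat x ^ m))"
proof -
  have "k \<ge> 2" using m k by simp
  show ?thesis unfolding even_part_power[OF \<open>k \<ge> 2\<close> m(1)]
  proof (intro val_ge_sum)
    fix l assume l: "l \<in> {1..m}"
    show "val_ge e (of_nat (Stirling m l) * even_coeff k m l)"
    proof (cases "2 * l \<le> k")
      case True
      define X where "X = int m - int l + \<sigma> (2 * K - 2 * l) - \<sigma> (2 * K - l - 1) + \<nu> m
      + (\<sigma> i + \<sigma> (K - 1 - i) - \<sigma> (K - 1))"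
      have "0 \<le> X + (\<sigma> l - \<sigma> m) \<or> 0 \<le> X + (\<nu> l - \<nu> m - 1)"
      proof (cases "even m")
        case True
        then show ?thesis using X_def i m l k \<open>2 * l \<le> k\<close>
          by (intro Stirling_bounds_suffice_even[of m i K l]) (auto elim: evenE)
      next
        case False
        then show ?thesis using X_def i m l k \<open>2 * l \<le> k\<close>
          by (intro Stirling_bounds_suffice_odd[of m i K l]) (auto elim: oddE simp: multiplicity_two_odd)
      qed
      then show ?thesis
      proof
        assume "0 \<le> X + (\<sigma> l - \<sigma> m)"
        then show ?thesis using True l unfolding X_def e k
          by (intro val_ge_even_term[OF _ _ val_ge_Stirling_digit_sum]) auto
      next
        assume "0 \<le> X + (\<nu> l - \<nu> m - 1)"
        then show ?thesis using True l unfolding X_def e k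
          by (intro val_ge_even_term[OF _ _ val_ge_Stirling_val]) auto
      qed
    next
      case False
      then show ?thesis using \<open>k \<ge> 2\<close> by (simp add: even_coeff_eq_0)
    qed
  qed
qed

text \<open>A variant without the loss of \<nu>(m), for stability at exponent 0, where no \<nu>(u)
  compensates it. The digit sum bound alone suffices.\<close>

lemma val_ge_even_part_even_power:
  assumes k: "k = 2 * K" and m: "m = 2 * i" "1 \<le> i" "i < K"
    and e: "e = \<sigma> k - 1 - (\<sigma> i + \<sigma> (K - 1 - i) - \<sigma> (K - 1))"
  shows "val_ge e (even_part k (\<lambda>x. of_nat x ^ m))"
proof -
  have "k \<ge> 2" "1 \<le> m" using m k by simp_all
  show ?thesis unfolding even_part_power[OF \<open>k \<ge> 2\<close> \<open>1 \<le> m\<close>]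
  proof (intro val_ge_sum)
    fix l assume l: "l \<in> {1..m}"
    show "val_ge e (of_nat (Stirling m l) * even_coeff k m l)"
    proof (cases "2 * l \<le> k")
      case True
      have k1: "\<nu> k = \<nu> K + 1" unfolding k using m by (simp add: multiplicity_two_double)
      have K1: "\<sigma> (K - 1) = \<sigma> K + \<nu> K - 1" using m by (intro digit_sum_pred) simp
      have lK: "l \<le> K" using True k by simp
      have sm: "\<sigma> m = \<sigma> i" using m by simp
      have "e \<le> (\<sigma> l - \<sigma> m) + int m - int l - 2 + \<nu> k + \<sigma> k + \<sigma> (k - 2 * l) - \<sigma> (k - l - 1)"
      proof (cases "even l")
        case True
        then obtain r where r: "l = 2 * r" by blast
        then have r1: "1 \<le> r" using l by simp
        obtain d where d: "i = r + d" using m l r le_Suc_ex[of r i] by auto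
        have ml: "int m - int l = 2 * int d" "\<sigma> l = \<sigma> r" using r d m by simp_all
        show ?thesis using digit_sum_gap_even[OF r r1 lK d m(3)] ml digit_sum_le[of d]
          unfolding e k1 K1 sm unfolding k by linarith
      next
        case False
        then obtain r where r: "l = 2 * r + 1" by (rule oddE)
        obtain d where d: "i = r + d" using m l r le_Suc_ex[of r i] by auto
        have ml: "int m - int l = 2 * int d - 1" "\<sigma> l = \<sigma> r + 1" unfolding r d m by simp_all
        show ?thesis using digit_sum_gap_odd[OF r lK d m(3)] ml digit_sum_le[of d] K1
          unfolding e k1 sm unfolding k by linarith
      qed
      then show ?thesis using True l
        by (intro val_ge_even_term[OF _ _ val_ge_Stirling_digit_sum]) auto
    next
      case False
      then show ?thesis using \<open>k \<ge> 2\<close> by (simp add: even_coeff_eq_0)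
    qed
  qed
qed

text \<open>The factor 2^n pays for everything: the digit sum difference costs at most l - 1, and 2l
  \<le> k < n.\<close>

lemma val_ge_even_part_high_power:
  assumes "k \<ge> 2" "n > k"
  shows "val_ge (\<nu> k + \<sigma> k - 1) (even_part k (\<lambda>x. of_nat x ^ n))"
proof -
  have "n \<ge> 1" using assms by simp
  show ?thesis unfolding even_part_power[OF assms(1) \<open>n \<ge> 1\<close>]
  proof (intro val_ge_sum)
    fix l assume l: "l \<in> {1..n}"
    show "val_ge (\<nu> k + \<sigma> k - 1) (of_nat (Stirling n l) * even_coeff k n l)"
    proof (cases "2 * l \<le> k")
      case True
      have "k - l - 1 = (k - 2 * l) + (l - 1)" using True l by auto
      then have "\<sigma> (k - l - 1) \<le> \<sigma> (k - 2 * l) + int (l - 1)"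
        using digit_sum_add_le[of "k - 2 * l" "l - 1"] digit_sum_le[of "l - 1"] by simp
      then show ?thesis using True l assms
        by (intro val_ge_even_term[OF _ _ val_ge_of_nat]) auto
    next
      case False
      then show ?thesis using assms by (simp add: even_coeff_eq_0)
    qed
  qed
qed

section \<open>The even part at small exponents\<close>

text \<open>k - 2l and k - l - 1 arise from 2^a q - 1 by subtracting 2l - 1 and l without a borrow
  from its high part q - 1, so the difference is \<sigma>(l) - \<sigma>(2l - 1) = -\<nu>(l). At l =
  2^a both high parts are q - 2, with the same result.\<close>

lemma digit_sum_gap_eq:
  assumes k: "k = 2 ^ a * q" and l: "1 \<le> l" "2 * l \<le> k" "2 * l \<le> 2 ^ a \<or> l = 2 ^ a"
  shows "\<sigma> (k - 2 * l) - \<sigma> (k - l - 1) = - \<nu> l"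
  using l(3)
proof
  assume small: "2 * l \<le> 2 ^ a"
  have q: "q \<ge> 1" using k l by (cases q) auto
  have "k - 2 * l = 2 ^ a * q - 1 - (2 * (l - 1) + 1)" using k l by simp
  moreover have "2 * (l - 1) + 1 < 2 ^ a" using small l by linarith
  ultimately have "\<sigma> (k - 2 * l) = \<sigma> (q - 1) + int a - (\<sigma> (l - 1) + 1)"
    using digit_sum_borrow[OF _ q] by (metis digit_sum_double_Suc' of_nat_1 of_nat_add)
  moreover have "k - l - 1 = 2 ^ a * q - 1 - l" using k by simp
  then have "\<sigma> (k - l - 1) = \<sigma> (q - 1) + int a - \<sigma> l"
    using digit_sum_borrow[OF _ q, of l a] small l by simp
  ultimately show ?thesis using digit_sum_pred[OF l(1)] by simp
next
  assume l_eq: "l = 2 ^ a"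
  have q: "q - 1 \<ge> 1"
  proof -
    have "2 ^ a * 2 \<le> 2 ^ a * q" using l k l_eq by simp
    then show ?thesis by simp
  qed
  have "k - 2 * l = 2 ^ a * (q - 2)" using k l_eq by (simp add: diff_mult_distrib2)
  then have "\<sigma> (k - 2 * l) = \<sigma> (q - 2)" by simp
  moreover have "k - l - 1 = 2 ^ a * (q - 1) - 1 - 0" using k l_eq by (simp add: diff_mult_distrib2)
  then have "\<sigma> (k - l - 1) = \<sigma> (q - 1 - 1) + int a - \<sigma> 0"
    using digit_sum_borrow[OF _ q, of 0 a] by simp
  moreover have "\<nu> l = int a" unfolding l_eq by simp
  ultimately show ?thesis by (simp add: numeral_2_eq_2)
qed

text \<open>Subtracting 2l - 1 now lowers the high part q - 1, while subtracting l does not. As q -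
  1 is even and positive, its digit sum does not drop, but the top digit of 2l - 1 is no longer
  charged to the low part: one is gained.\<close>

lemma digit_sum_gap_ge:
  assumes k: "k = 2 ^ a * q" "odd q" and l: "2 * l \<le> k" "2 ^ a < 2 * l" "l < 2 ^ a"
  shows "\<sigma> (k - 2 * l) - \<sigma> (k - l - 1) \<ge> 1 - \<nu> l"
proof -
  have l1: "1 \<le> l" using l by (cases l) auto
  have "2 ^ a * 1 < 2 ^ a * q" using l k by linarith
  then have "q > 1" by simp
  then obtain t where t: "q = 2 * t + 1" "t \<ge> 1" using k by (auto elim!: oddE)
  define r where "r = 2 * (l - 1) + 1 - 2 ^ a"
  have r: "r < 2 ^ a" "2 ^ a * 1 + r = 2 * (l - 1) + 1"
    using l l1 unfolding r_def by auto
  have "\<sigma> (l - 1) + 1 = 1 + \<sigma> r"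
    using digit_sum_split[OF r(1), of 1] unfolding r(2) digit_sum_double_Suc' by simp
  moreover have "k - 2 * l = 2 ^ a * (q - 1) - 1 - r"
    using r l1 k(1) by (simp add: diff_mult_distrib2)
  then have "\<sigma> (k - 2 * l) = \<sigma> (q - 1 - 1) + int a - \<sigma> r"
    using digit_sum_borrow[OF r(1), of "q - 1"] t by simp
  moreover have "q - 1 - 1 = 2 * (t - 1) + 1" using t by simp
  then have "\<sigma> (q - 1 - 1) = \<sigma> (t - 1) + 1" by (simp only: digit_sum_double_Suc')
  moreover have "k - l - 1 = 2 ^ a * q - 1 - l" using k by simp
  then have "\<sigma> (k - l - 1) = \<sigma> (q - 1) + int a - \<sigma> l"
    using digit_sum_borrow[OF l(3), of q] t by simp
  moreover have "\<sigma> (q - 1) = \<sigma> t" using t by simp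
  ultimately show ?thesis using digit_sum_pred[OF l1] digit_sum_pred[OF t(2)] by linarith
qed

lemma val_eq_Stirling_Suc_self:
  assumes "even n" "n \<ge> 2"
  shows "val_eq (\<nu> n - 1) (of_nat (Stirling (Suc n) n))"
proof -
  have "2 * Stirling (Suc n) n = Suc n * n"
    unfolding Stirling_Suc_self choose_two using assms by simp
  then have "2 * rat_of_nat (Stirling (Suc n) n) = of_nat (Suc n) * of_nat n"
    by (metis of_nat_mult of_nat_numeral)
  then have "rat_of_nat (Stirling (Suc n) n) = of_nat (Suc n) * of_nat n / 2"
    by simp
  moreover have "val_eq (0 + \<nu> n - 1) (of_nat (Suc n) * of_nat n / 2)"
  proof (intro val_eq_divide val_eq_mult)
    show "val_eq 0 (of_nat (Suc n))"
      using assms by (subst val_eq_of_nat_iff) (simp_all add: multiplicity_two_odd)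
    show "val_eq (\<nu> n) (of_nat n)" using assms by (intro val_eq_of_nat) simp
    show "val_eq 1 2" using val_eq_2_power[of 1] by simp
  qed
  ultimately show ?thesis by (simp only: add_0)
qed

lemma val_eq_even_term:
  assumes "l \<ge> 1" "2 * l \<le> k" "val_eq s (of_nat (Stirling n l))"
    "e = s + int n - int l - 2 + \<nu> k + \<sigma> k + \<sigma> (k - 2 * l) - \<sigma> (k - l - 1)"
  shows "val_eq e (of_nat (Stirling n l) * even_coeff k n l)"
proof -
  have "e = s + (int n - int l - 2 + \<nu> k + \<sigma> k + \<sigma> (k - 2 * l) - \<sigma> (k - l - 1))"
    using assms(4) by simp
  then show ?thesis
    using val_eq_mult[OF assms(3) val_eq_even_coeff[OF assms(1,2), of n]] by simp
qed

text \<open>Only the terms \<open>l = u\<close> and, for odd \<open>u\<close>, \<open>l = u - 1\<close> of \<open>even_part_power\<close> can reach the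
  minimal valuation; if both do, they cancel to first order.\<close>

lemma val_even_part_small_power:
  assumes k: "k \<ge> 2" and u: "1 \<le> u" "u < k" "u \<le> 2 ^ a" and a: "a = multiplicity 2 k"
    and e: "e = \<nu> k + \<sigma> k - 2 - \<nu> u"
  shows "if u = 1 \<or> even u \<and> 2 * u \<le> 2 ^ a \<or> 2 * (u - 1) = 2 ^ a \<or> u = 2 ^ a
    then val_eq e (even_part k (\<lambda>x. of_nat x ^ u))
    else val_ge (e + 1) (even_part k (\<lambda>x. of_nat x ^ u))"
proof -
  obtain q where q: "k = 2 ^ a * q" "odd q"
    using multiplicity_decompose'[of k 2] k a by auto
  define t where "t l = of_nat (Stirling u l) * even_coeff k u l" for l
  have gap: "\<sigma> (k - 2 * l) - \<sigma> (k - l - 1) \<ge> - \<nu> l"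
    if "1 \<le> l" "2 * l \<le> k" "l \<le> 2 ^ a" for l
    using digit_sum_gap_eq[OF q(1) that(1,2)] digit_sum_gap_ge[OF q that(2)] that(3)
    by (cases "2 * l \<le> 2 ^ a \<or> l = 2 ^ a") auto
  \<comment> \<open>For l \<le> u - 2 the gain u - l covers the loss of 1 in
    \<open>val_ge_Stirling_val\<close>, whose \<nu>(l) cancels the digit sum difference. For l = u -
    1 with u even, l is odd and there is nothing to cancel.\<close>
  have below: "val_ge (e + 1) (t l)" if l: "1 \<le> l" "l < u" and ne: "\<not> (odd u \<and> l = u - 1)" for l
  proof (cases "2 * l \<le> k")
    case True
    have gap': "\<sigma> (k - 2 * l) - \<sigma> (k - l - 1) \<ge> - \<nu> l"
      using gap[OF l(1) True] l u by simp
    show ?thesis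
    proof (cases "l + 2 \<le> u")
      case True
      then show ?thesis unfolding t_def using l u gap' e \<open>2 * l \<le> k\<close>
        by (intro val_ge_even_term[OF _ _ val_ge_Stirling_val]) auto
    next
      case False
      then have "u = Suc l" using l by simp
      then have "odd l" using ne by auto
      then have "\<nu> l = 0" by (simp add: multiplicity_two_odd)
      then show ?thesis unfolding t_def using l gap' e \<open>2 * l \<le> k\<close> \<open>u = Suc l\<close>
        by (intro val_ge_even_term[OF _ _ val_ge_of_nat]) auto
    qed
  next
    case False
    then show ?thesis unfolding t_def using k by (simp add: even_coeff_eq_0)
  qed
  have top_eq: "val_eq e (t u)" if "2 * u \<le> 2 ^ a \<or> u = 2 ^ a"
  proof -
    have "2 ^ a \<le> k" unfolding q(1) using q(2) by (cases q) auto
    moreover have "2 * u \<le> k" if "u = 2 ^ a"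
    proof -
      have "q \<noteq> 0" "q \<noteq> 1" using u q that by auto
      then show ?thesis unfolding that q(1) by simp
    qed
    ultimately have "2 * u \<le> k" using \<open>2 * u \<le> 2 ^ a \<or> u = 2 ^ a\<close> by auto
    then show ?thesis unfolding t_def using u e digit_sum_gap_eq[OF q(1) u(1) \<open>2 * u \<le> k\<close> that] val_eq_of_int[of 1]
      by (intro val_eq_even_term[of _ _ 0]) auto
  qed
  have top_ge: "val_ge (e + 1) (t u)" if "2 ^ a < 2 * u" "u < 2 ^ a"
  proof (cases "2 * u \<le> k")
    case True
    then show ?thesis unfolding t_def using u e digit_sum_gap_ge[OF q True that]
      by (intro val_ge_even_term[OF _ _ val_ge_of_nat]) auto
  next
    case False
    then show ?thesis unfolding t_def using k by (simp add: even_coeff_eq_0)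
  qed
  have expand: "even_part k (\<lambda>x. of_nat x ^ u) = t u + (\<Sum>l=1..<u. t l)"
    unfolding even_part_power[OF k u(1)] t_def[symmetric]
    using u by (simp add: atLeastLessThanSuc_atLeastAtMost[symmetric])
  show ?thesis
  proof (cases "even u \<or> u = 1")
    case True
    have rest: "val_ge (e + 1) (\<Sum>l=1..<u. t l)"
      using True by (intro val_ge_sum below) auto
    show ?thesis
    proof (cases "2 * u \<le> 2 ^ a \<or> u = 2 ^ a")
      case top: True
      have "u = 1 \<or> even u \<and> 2 * u \<le> 2 ^ a \<or> 2 * (u - 1) = 2 ^ a \<or> u = 2 ^ a"
        using True top by auto
      then show ?thesis unfolding expand using top_eq[OF top] rest val_eq_add by auto
    next
      case False
      then have lt: "2 ^ a < 2 * u" "u < 2 ^ a" using u by auto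
      have "u \<noteq> 1"
      proof
        assume "u = 1"
        then show False using lt by (cases a) auto
      qed
      moreover have "2 * (u - 1) \<noteq> 2 ^ a"
      proof
        assume *: "2 * (u - 1) = 2 ^ a"
        have "odd (u - 1)" using True \<open>u \<noteq> 1\<close> u by simp
        obtain b where b: "a = Suc b" using * by (cases a) (auto simp: dvd_def)
        then have "u - 1 = 2 ^ b" using * by simp
        then have "odd ((2::nat) ^ b)" using \<open>odd (u - 1)\<close> by metis
        then have "b = 0" by simp
        then show False using * b lt by auto
      qed
      ultimately show ?thesis unfolding expand using top_ge[OF lt] rest val_ge_add False by auto
    qed
  next
    case False
    then have odd: "odd u" and u3: "u \<ge> 3" using u by (auto elim!: oddE)
    have ne: "u \<noteq> 2 ^ a" using odd u3 by (cases a) auto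
    obtain v where v: "u = Suc v" using u by (cases u) auto
    have v2: "v \<ge> 2" "even v" using v odd u3 by auto
    have nu: "\<nu> u = 0" using odd by (simp add: multiplicity_two_odd)
    have expand': "even_part k (\<lambda>x. of_nat x ^ u) = t u + (t v + (\<Sum>l=1..<v. t l))"
      unfolding expand using v v2 by simp
    have rest: "val_ge (e + 1) (\<Sum>l=1..<v. t l)"
      using v by (intro val_ge_sum below) auto
    \<comment> \<open>S(u, u - 1) has valuation \<nu>(v) - 1, the term u - l adds 1, and the digit
      sums lose \<nu>(v): the same total as for l = u.\<close>
    have pen_eq: "val_eq e (t v)" if "2 * v \<le> 2 ^ a"
    proof -
      have "2 ^ a \<le> k" unfolding q(1) using q(2) by (cases q) auto
      then have "2 * v \<le> k" using that by simp
      then show ?thesis unfolding t_def using v v2 that nu e digit_sum_gap_eq[OF q(1) _ \<open>2 * v \<le> k\<close>]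
          val_eq_Stirling_Suc_self[OF v2(2,1)]
        by (intro val_eq_even_term[of _ _ "\<nu> v - 1"]) auto
    qed
    have pen_ge: "val_ge (e + 1) (t v)" if "2 ^ a < 2 * v"
    proof (cases "2 * v \<le> k")
      case True
      then show ?thesis unfolding t_def using v v2 u e nu digit_sum_gap_ge[OF q True that]
        by (intro val_ge_even_term[OF _ _ val_ge_Stirling_val]) auto
    next
      case False
      then show ?thesis unfolding t_def using k by (simp add: even_coeff_eq_0)
    qed
    \<comment> \<open>Below the threshold 2^a / 2 both terms are minimal and cancel; above it
      neither is. If v sits exactly on it, only l = v counts, whence the exceptional u = 1 + 2^(a -
      1).\<close>
    consider (both) "2 * u \<le> 2 ^ a" | (one) "2 * v = 2 ^ a" | (none) "2 ^ a < 2 * v"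
    proof -
      have "2 ^ a \<noteq> 2 * v + 1"
      proof
        assume *: "2 ^ a = 2 * v + 1"
        have "odd ((2::nat) ^ a)" unfolding * by simp
        then have "a = 0" by simp
        then show False using * v2 by simp
      qed
      moreover have "2 * u \<le> 2 ^ a \<or> 2 * v = 2 ^ a \<or> 2 ^ a = 2 * v + 1 \<or> 2 ^ a < 2 * v"
        unfolding v by auto
      ultimately show ?thesis using that by blast
    qed
    then show ?thesis
    proof cases
      case both
      have "val_ge (e + 1) (t u + t v + (\<Sum>l=1..<v. t l))"
        using both v by (intro val_ge_add[OF _ rest] val_eq_add_val_eq top_eq pen_eq) auto
      moreover have "\<not> (u = 1 \<or> even u \<and> 2 * u \<le> 2 ^ a \<or> 2 * (u - 1) = 2 ^ a \<or> u = 2 ^ a)"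
        using both odd u3 ne by auto
      ultimately show ?thesis unfolding expand' by (simp only: if_False add.assoc)
    next
      case one
      have "val_ge (e + 1) (t u)" using one v ne u by (intro top_ge) auto
      moreover have "val_eq e (t v + (\<Sum>l=1..<v. t l))"
        using one by (intro val_eq_add pen_eq rest) simp
      ultimately have "val_eq e (even_part k (\<lambda>x. of_nat x ^ u))"
        unfolding expand' using val_eq_add by (metis add.commute)
      then show ?thesis using one v by simp
    next
      case none
      have "val_ge (e + 1) (t u)" using none v ne u by (intro top_ge) auto
      then have "val_ge (e + 1) (even_part k (\<lambda>x. of_nat x ^ u))"
        unfolding expand' using none by (intro val_ge_add pen_ge rest)
      moreover have "\<not> (u = 1 \<or> even u \<and> 2 * u \<le> 2 ^ a \<or> 2 * (u - 1) = 2 ^ a \<or> u = 2 ^ a)"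
        using none v odd u3 ne by auto
      ultimately show ?thesis by (simp only: if_False)
    qed
  qed
qed

section \<open>Interpolation of the odd part\<close>

definition interp_coeff :: "nat \<Rightarrow> nat \<Rightarrow> nat \<Rightarrow> rat"
  where "interp_coeff K W i = (-1) ^ (K - 1 - i) * of_nat (W choose i) * of_nat ((W - i - 1) choose (K - 1 - i))"

text \<open>The coefficients are the values at \<open>W\<close> of the Lagrange basis polynomials for the nodes
  \<open>0, \<dots>, K - 1\<close>.\<close>

lemma power_interpolation:
  fixes y :: rat
  shows "K \<le> W \<Longrightarrow> y ^ W = (\<Sum>i<K. interp_coeff K W i * y ^ i) + (\<Sum>r=K..W. of_nat (W choose r) * (y - 1) ^ r)"
proof (induction K)
  case 0
  have "y ^ W = ((y - 1) + 1) ^ W" by simp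
  also have "\<dots> = (\<Sum>r\<le>W. of_nat (W choose r) * (y - 1) ^ r)"
    by (subst binomial_ring) simp
  finally show ?case by (simp add: atMost_atLeast0)
next
  case (Suc K)
  \<comment> \<open>Passing from K to K + 1 expands the remainder term r = K in powers of y;
    trinomial revision and Pascal's rule identify the change at y^i.\<close>
  have step: "interp_coeff (Suc K) W i = interp_coeff K W i + of_nat (W choose K) * (of_nat (K choose i) * (-1) ^ (K - i))"
    if i: "i < K" for i
  proof -
    define t where "t = K - 1 - i"
    have t: "K - i = Suc t" "K = Suc (i + t)" using i unfolding t_def by auto
    obtain w where w: "W - i = Suc w" using i Suc by (cases "W - i") auto
    have "(W choose i) * ((W - i) choose (K - i)) = (W choose K) * (K choose i)"
      using i Suc by (simp add: choose_mult)
    then have "rat_of_nat (W choose i) * of_nat ((W - i) choose (K - i)) = of_nat (W choose K) * of_nat (K choose i)"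
      by (metis of_nat_mult)
    moreover have "(W - i) choose (K - i) = (w choose t) + (w choose Suc t)"
      unfolding w t by simp
    ultimately have eq: "rat_of_nat (W choose K) * of_nat (K choose i) = of_nat (W choose i) * (of_nat (w choose t) + of_nat (w choose Suc t))"
      by simp
    have idx: "W - i - 1 = w" "K - 1 - i = t" "Suc K - 1 - i = Suc t"
      using w t i by auto
    have "of_nat (W choose K) * (of_nat (K choose i) * (-1) ^ (K - i))
        = - ((-1) ^ t * (rat_of_nat (W choose K) * of_nat (K choose i)))"
      unfolding t(1) by simp
    then show ?thesis unfolding interp_coeff_def idx eq by (simp add: algebra_simps)
  qed
  have "(y - 1) ^ K = (\<Sum>i\<le>K. of_nat (K choose i) * y ^ i * (-1) ^ (K - i))"
    using binomial_ring[of y "-1" K] by simp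
  also have "\<dots> = (\<Sum>i<K. of_nat (K choose i) * (-1) ^ (K - i) * y ^ i) + y ^ K"
    by (simp add: lessThan_Suc_atMost[symmetric] mult_ac)
  finally have pow: "of_nat (W choose K) * (y - 1) ^ K
      = (\<Sum>i<K. of_nat (W choose K) * (of_nat (K choose i) * (-1) ^ (K - i)) * y ^ i) + of_nat (W choose K) * y ^ K"
    by (simp add: sum_distrib_left algebra_simps)
  have "(\<Sum>r=K..W. of_nat (W choose r) * (y - 1) ^ r)
      = of_nat (W choose K) * (y - 1) ^ K + (\<Sum>r=Suc K..W. of_nat (W choose r) * (y - 1) ^ r)"
    using Suc.prems by (intro sum.atLeast_Suc_atMost) simp
  moreover have "(\<Sum>i<Suc K. interp_coeff (Suc K) W i * y ^ i)
      = (\<Sum>i<K. interp_coeff K W i * y ^ i)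
        + (\<Sum>i<K. of_nat (W choose K) * (of_nat (K choose i) * (-1) ^ (K - i)) * y ^ i) + of_nat (W choose K) * y ^ K"
    using step by (simp add: interp_coeff_def[of "Suc K" W K] sum.distrib[symmetric] algebra_simps)
  ultimately show ?case using Suc pow by simp
qed

text \<open>Multiplied by the distance W - i, the coefficient becomes
  \<open>(K - 1) choose i\<close> times a factor that, up to sign, is the same for all nodes. This
  transfers information from one node to another.\<close>

lemma times_interp_coeff:
  assumes "i < K" "K \<le> W"
  shows "of_nat (W - i) * interp_coeff K W i = (-1) ^ (K - 1 - i) * (of_nat ((K - 1) choose i) * of_nat (K * (W choose K)))"
proof -
  define t where "t = K - 1 - i"
  have t: "K - i = Suc t" "K = Suc (i + t)" using assms unfolding t_def by auto
  obtain w where w: "W - i = Suc w" using assms by (cases "W - i") auto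
  have "(W choose i) * (Suc w * (w choose t)) = (W choose i) * (Suc t * (Suc w choose Suc t))"
    by (simp only: Suc_times_binomial_eq mult.commute)
  also have "\<dots> = Suc t * ((W choose i) * ((W - i) choose (K - i)))"
    unfolding w t(1) by (rule mult.left_commute)
  also have "\<dots> = Suc t * ((W choose K) * (K choose i))"
    using assms by (simp add: choose_mult)
  also have "\<dots> = (W choose K) * ((K - i) * (K choose i))"
    unfolding t(1) by (rule mult.left_commute)
  also have "\<dots> = ((K - 1) choose i) * (K * (W choose K))"
    unfolding binomial_absorb_comp by (simp only: mult_ac)
  finally have "rat_of_nat (W choose i) * (of_nat (Suc w) * of_nat (w choose t)) = of_nat ((K - 1) choose i) * of_nat (K * (W choose K))"
    by (metis of_nat_mult)
  moreover have "W - i - 1 = w" "K - 1 - i = t" using w t by auto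
  ultimately show ?thesis unfolding interp_coeff_def w by (simp add: mult_ac del: of_nat_mult of_nat_Suc)
qed

text \<open>Adding w to M produces no carry, and M - 1 ends in H ones, so both binomial coefficients
  are odd.\<close>

lemma val_eq_interp_coeff_centre:
  assumes "2 ^ H dvd M" "M > 0" "K \<le> 2 ^ H" "w < K"
  shows "val_eq 0 (interp_coeff K (M + w) w)"
proof -
  obtain q where q: "M = 2 ^ H * q" using assms by (elim dvdE)
  have q1: "q \<ge> 1" using q assms by (cases q) auto
  have "\<sigma> (M + w) = \<sigma> M + \<sigma> w"
    unfolding q using assms by (subst digit_sum_split) auto
  then have "val_eq 0 (of_nat ((M + w) choose w))"
    using val_eq_binomial[of w M] by (simp add: add.commute)
  moreover have "val_eq 0 (of_nat ((M - 1) choose (K - 1 - w)))"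
  proof -
    have le: "K - 1 - w \<le> M - 1"
      using assms(3) dvd_imp_le[OF assms(1,2)] by linarith
    have "\<sigma> (M - 1 - (K - 1 - w)) = \<sigma> (q - 1) + int H - \<sigma> (K - 1 - w)"
      unfolding q using assms q1 by (intro digit_sum_borrow) auto
    moreover have "\<sigma> (M - 1) = \<sigma> (q - 1) + int H"
      using digit_sum_borrow[OF _ q1, of 0 H] unfolding q by simp
    ultimately show ?thesis using val_eq_binomial'[OF le] by simp
  qed
  moreover have "val_eq 0 ((-1) ^ (K - 1 - w))"
    using val_eq_of_int[of "(-1) ^ (K - 1 - w)"] by simp
  ultimately have "val_eq (0 + 0 + 0) (interp_coeff K (M + w) w)"
    unfolding interp_coeff_def using assms by (intro val_eq_mult) (simp_all add: diff_right_commute)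
  then show ?thesis by simp
qed

text \<open>The assumption \<open>centre\<close> says that \<open>(K - 1) choose w\<close> is odd.
  \<open>times_interp_coeff\<close> at node w then shows that K ((M + w) choose K) has valuation at
  least H, and at node i it turns this into the bound.\<close>

lemma val_ge_interp_coeff:
  assumes "2 ^ H dvd M" "M > 0" "K \<le> 2 ^ H" "w < K" "i < K"
    and centre: "\<sigma> w + \<sigma> (K - 1 - w) - \<sigma> (K - 1) = 0"
  shows "val_ge (int H + (\<sigma> i + \<sigma> (K - 1 - i) - \<sigma> (K - 1)) - \<nu> (M + w - i)) (interp_coeff K (M + w) i)"
proof -
  have KM: "K \<le> M" using assms(3) dvd_imp_le[OF assms(1,2)] by linarith
  define Z where "Z = rat_of_nat (K * ((M + w) choose K))"
  have unit: "val_eq 0 ((-1) ^ n)" for n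
    using val_eq_of_int[of "(-1) ^ n"] by simp
  have Cw: "val_eq 0 (of_nat ((K - 1) choose w))"
    using val_eq_binomial'[of w "K - 1"] centre assms by simp
  have "Z = of_nat M * interp_coeff K (M + w) w / ((-1) ^ (K - 1 - w) * of_nat ((K - 1) choose w))"
    using times_interp_coeff[OF assms(4), of "M + w"] KM val_eq_nonzero[OF Cw] unfolding Z_def by simp
  moreover have "val_ge (int H) (of_nat M)"
    using assms by (subst val_ge_of_nat_iff) (simp_all add: multiplicity_geI)
  ultimately have "val_ge (int H + 0 - (0 + 0)) Z"
    using val_eq_imp_ge[OF val_eq_interp_coeff_centre[OF assms(1-4)]]
    by (simp only:) (intro val_ge_divide val_ge_mult val_eq_mult unit Cw)
  then have Z: "val_ge (int H) Z" by simp
  have pos: "M + w - i > 0" using KM assms by simp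
  have "interp_coeff K (M + w) i = (-1) ^ (K - 1 - i) * (of_nat ((K - 1) choose i) * Z) / of_nat (M + w - i)"
    using times_interp_coeff[OF assms(5), of "M + w"] KM pos unfolding Z_def by (simp add: field_simps del: of_nat_mult of_nat_diff)
  also have "val_ge (0 + ((\<sigma> i + \<sigma> (K - 1 - i) - \<sigma> (K - 1)) + int H) - \<nu> (M + w - i)) \<dots>"
    using assms pos by (intro val_ge_divide val_ge_mult val_eq_imp_ge[OF unit] Z val_eq_of_nat
        val_eq_imp_ge[OF val_eq_binomial']) auto
  finally show ?thesis by (simp add: algebra_simps)
qed

lemma val_odd_part_one:
  assumes "k \<ge> 1"
  shows "val_eq (\<sigma> k - 1) (odd_part k (\<lambda>x. 1))"
proof -
  have "val_eq (int (k - 1) - (int k - \<sigma> k)) (odd_part k (\<lambda>x. 1))"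
    unfolding odd_part_one[OF assms] by (intro val_eq_divide val_eq_2_power val_eq_fact)
  then show ?thesis using assms by (simp add: of_nat_diff)
qed

lemma val_less_of_less_power:
  assumes "0 < m" "m < 2 ^ h"
  shows "\<nu> m < int h"
proof (rule ccontr)
  assume "\<not> \<nu> m < int h"
  then have "2 ^ h dvd m" by (intro multiplicity_dvd') simp
  then show False using assms by (auto dest: dvd_imp_le)
qed

text \<open>m and u differ modulo 2^h, so \<nu>(N + u - m) < h. If it is at most \<nu>(u), then
  \<nu>(m) < h finishes. Otherwise N and N + u - m are divisible by a higher power of 2 than u,
  which forces \<nu>(m) \<le> \<nu>(u).\<close>

lemma val_shifted_diff:
  assumes "2 ^ h dvd N" "2 ^ h \<le> N" "0 < m" "m < 2 ^ h" "0 < u" "u < 2 ^ h" "m \<noteq> u"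
  shows "\<nu> (N + u - m) + \<nu> m + 1 \<le> int h + \<nu> u"
proof -
  define X where "X = N + u - m"
  have X: "X + m = N + u" "X > 0" using assms unfolding X_def by auto
  have m: "\<nu> m < int h" using assms by (intro val_less_of_less_power)
  have u: "\<nu> u < int h" using assms by (intro val_less_of_less_power)
  have Xh: "\<nu> X < int h"
  proof (rule ccontr)
    assume "\<not> \<nu> X < int h"
    then have "2 ^ h dvd X" by (intro multiplicity_dvd') simp
    then obtain c where c: "X = 2 ^ h * c" by (elim dvdE)
    obtain d where d: "N = 2 ^ h * d" using assms(1) by (elim dvdE)
    have "(2 ^ h * c + m) mod 2 ^ h = (2 ^ h * d + u) mod 2 ^ h"
      using X(1) unfolding c d by simp
    then show False using assms by simp
  qed
  show ?thesis
  proof (cases "\<nu> X \<le> \<nu> u")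
    case True
    then show ?thesis using m unfolding X_def by simp
  next
    case False
    define b where "b = multiplicity 2 u"
    have "2 ^ Suc b dvd X" using False unfolding b_def by (intro multiplicity_dvd') simp
    moreover have "2 ^ Suc b dvd N"
      using assms(1) u unfolding b_def by (meson Suc_leI dvd_trans le_imp_power_dvd of_nat_less_iff)
    moreover have "\<not> 2 ^ Suc b dvd u"
    proof
      assume "2 ^ Suc b dvd u"
      then have "Suc b \<le> multiplicity 2 u" using assms by (intro multiplicity_geI) auto
      then show False unfolding b_def by simp
    qed
    ultimately have "\<not> 2 ^ Suc b dvd m" using X by (metis dvd_add_right_iff)
    then have "multiplicity 2 m \<le> b" by (meson multiplicity_dvd' not_less_eq_eq)
    then show ?thesis using Xh unfolding X_def b_def by simp
  qed
qed

section \<open>Stability of the odd part\<close>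

text \<open>Interpolating in y = x^2 preserves the parity p of the exponents and leaves powers of
  x^2 - 1 from K on, which are highly even at odd x.\<close>

lemma odd_part_interpolation:
  assumes k: "k = 2 * K" "K \<ge> 1" and W: "K \<le> W"
  obtains t where "val_ge (\<sigma> k - 1 + \<nu> k) t"
    "odd_part k (\<lambda>x. of_nat x ^ (2 * W + p)) = (\<Sum>i<K. interp_coeff K W i * odd_part k (\<lambda>x. of_nat x ^ (2 * i + p))) + t"
proof -
  define t where "t = (\<Sum>r=K..W. of_nat (W choose r) * odd_part k (\<lambda>x. of_nat x ^ p * (of_nat x ^ 2 - 1) ^ r))"
  have "val_ge (\<sigma> k - 1 + \<nu> k) (of_nat (W choose r) * odd_part k (\<lambda>x. of_nat x ^ p * (of_nat x ^ 2 - 1) ^ r))"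
    if "r \<in> {K..W}" for r
    using val_ge_mult[OF val_ge_of_nat val_ge_odd_part_high[OF k, of r p]] that by simp
  then have "val_ge (\<sigma> k - 1 + \<nu> k) t" unfolding t_def by (rule val_ge_sum)
  moreover have "odd_part k (\<lambda>x. of_nat x ^ (2 * W + p))
      = (\<Sum>i<K. interp_coeff K W i * odd_part k (\<lambda>x. of_nat x ^ (2 * i + p))) + t"
  proof -
    have "rat_of_nat x ^ (2 * W + p)
      = (\<Sum>i<K. interp_coeff K W i * of_nat x ^ (2 * i + p))
        + (\<Sum>r=K..W. of_nat (W choose r) * (of_nat x ^ p * (of_nat x ^ 2 - 1) ^ r))" for x
    proof -
      have fold: "rat_of_nat x ^ p * (of_nat x ^ 2) ^ i = of_nat x ^ (2 * i + p)" for i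
        by (simp add: power_add power_mult[symmetric])
      have "rat_of_nat x ^ (2 * W + p) = of_nat x ^ p * (of_nat x ^ 2) ^ W"
        unfolding fold ..
      also have "\<dots> = (\<Sum>i<K. interp_coeff K W i * (of_nat x ^ p * (of_nat x ^ 2) ^ i))
        + (\<Sum>r=K..W. of_nat (W choose r) * (of_nat x ^ p * (of_nat x ^ 2 - 1) ^ r))"
        unfolding power_interpolation[OF W, of "of_nat x ^ 2"]
        by (simp add: distrib_left sum_distrib_left mult_ac)
      finally show ?thesis unfolding fold .
    qed
    then show ?thesis
      unfolding t_def by (simp add: odd_part_add odd_part_sum odd_part_cmult)
  qed
  ultimately show ?thesis by (rule that)
qed

text \<open>u < 2^\<nu>(k) puts w = u div 2 below 2^\<nu>(K), so \<open>(K - 1) choose w\<close> is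
  odd. At the other nodes the valuation of \<open>(K - 1) choose i\<close> cancels; for positive m
  and u what remains is \<nu>(N + u - m) + \<nu>(m) + 1 \<le> h + \<nu>(u).\<close>

lemma odd_part_stable_even:
  assumes k: "k = 2 * K" "K \<ge> 1" "k \<le> 2 ^ h" and N: "2 ^ h dvd N" "N > 0"
    and u: "u < 2 ^ multiplicity 2 k"
    and e: "e = (if u = 0 then \<sigma> k else \<nu> k + \<sigma> k - 1 - \<nu> u)"
  shows "val_ge e (odd_part k (\<lambda>x. of_nat x ^ (N + u) - of_nat x ^ u))"
proof -
  obtain H where h: "h = Suc H" using k by (cases h) auto
  have KH: "K \<le> 2 ^ H" using k h by simp
  have Nh: "2 ^ h \<le> N" using N by (rule dvd_imp_le)
  define M where "M = N div 2"
  have "even N" using N(1) h by (auto elim!: dvdE)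
  then have NM: "N = 2 * M" unfolding M_def by simp
  have M: "2 ^ H dvd M" "M > 0" using N h NM by auto
  have KM: "K \<le> M" using KH dvd_imp_le[OF M] by simp
  define a where "a = multiplicity 2 K"
  have ka: "multiplicity 2 k = Suc a" unfolding k(1) a_def using k by (intro multiplicity_two_double) simp
  have k0: "k > 0" using k by simp
  define w p where "w = u div 2" and "p = u mod 2"
  have up: "u = 2 * w + p" unfolding w_def p_def by simp
  have w2: "w < 2 ^ a" using u unfolding ka w_def by simp
  have "2 ^ a \<le> K" unfolding a_def using k by (intro dvd_imp_le multiplicity_dvd) simp
  then have wK: "w < K" using w2 by simp
  have nuh: "\<nu> k \<le> int h"
  proof -
    have "2 ^ multiplicity 2 k \<le> k" using k0 by (intro dvd_imp_le multiplicity_dvd)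
    then have "(2::nat) ^ multiplicity 2 k \<le> 2 ^ h" using k(3) by (rule le_trans)
    then have "multiplicity 2 k \<le> h" by (rule power_le_imp_le_exp[rotated]) simp
    then show ?thesis by simp
  qed
  have uk: "u < k"
    using u dvd_imp_le[OF multiplicity_dvd[of 2 k] k0] by simp
  have uh: "u < 2 ^ h" using uk k by simp
  have centre: "\<sigma> w + \<sigma> (K - 1 - w) - \<sigma> (K - 1) = 0"
  proof -
    obtain q where q: "K = 2 ^ a * q" using multiplicity_dvd[of 2 K] unfolding a_def[symmetric] by (elim dvdE)
    have q1: "q \<ge> 1" using q k by (cases q) auto
    show ?thesis using digit_sum_borrow[OF w2 q1] digit_sum_borrow[OF _ q1, of 0 a] unfolding q by simp
  qed
  define L where "L = interp_coeff K (M + w)"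
  define F where "F m = odd_part k (\<lambda>x. of_nat x ^ m)" for m
  obtain t where t: "val_ge (\<sigma> k - 1 + \<nu> k) t" "F (2 * (M + w) + p) = (\<Sum>i<K. L i * F (2 * i + p)) + t"
    using odd_part_interpolation[OF k(1,2), of "M + w" p] KM unfolding F_def L_def by auto
  have nu_pos: "\<nu> k \<ge> 1" unfolding ka by simp
  have L_ge: "val_ge (int H + (\<sigma> i + \<sigma> (K - 1 - i) - \<sigma> (K - 1)) - \<nu> (M + w - i)) (L i)" if "i < K" for i
    unfolding L_def using that by (intro val_ge_interp_coeff M KH wK centre)
  have nu_half: "\<nu> (N + u - (2 * i + p)) = \<nu> (M + w - i) + 1" if "i < K" for i
  proof -
    have "N + u - (2 * i + p) = 2 * (M + w - i)" unfolding NM up by simp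
    moreover have "M + w - i > 0" using that KM M by simp
    ultimately show ?thesis by (simp add: multiplicity_two_double)
  qed
  have other: "val_ge e (L i * F (2 * i + p))" if i: "i < K" "i \<noteq> w" for i
  proof -
    define m where "m = 2 * i + p"
    have idiv: "i = m div 2" unfolding m_def p_def by simp
    have mk: "m < k" using i unfolding m_def p_def k(1) by linarith
    have mh: "m < 2 ^ h" using mk k by simp
    have F: "F m = even_part k (\<lambda>x. of_nat x ^ m)"
      unfolding F_def by (rule odd_part_power_eq_even_part[OF mk])
    have mu: "m \<noteq> u" using i unfolding m_def up by simp
    note nuX = nu_half[OF i(1), folded m_def]
    consider (zero) "u = 0" | (m0) "u > 0" "m = 0" | (pos) "u > 0" "m > 0" by auto
    then show ?thesis
    proof cases
      case zero
      then have m: "m = 2 * i" "1 \<le> i" using i unfolding m_def p_def w_def by auto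
      have "val_ge (\<sigma> k - 1 - (\<sigma> i + \<sigma> (K - 1 - i) - \<sigma> (K - 1))) (F m)"
        unfolding F by (rule val_ge_even_part_even_power[OF k(1) m i(1) refl])
      from val_ge_mult[OF L_ge[OF i(1)] this]
      show ?thesis unfolding m_def[symmetric]
      proof (rule val_ge_mono)
        have "\<nu> (N + u - m) < int h"
        proof -
          have "\<not> 2 ^ h dvd N - m"
          proof
            assume "2 ^ h dvd N - m"
            then have "2 ^ h dvd N - (N - m)" by (rule dvd_diff_nat[OF N(1)])
            moreover have "N - (N - m) = m" using mh Nh by simp
            ultimately have "2 ^ h dvd m" by (simp only:)
            then show False using mh m by (auto dest: dvd_imp_le)
          qed
          then have "\<not> h \<le> multiplicity 2 (N - m)" using multiplicity_dvd' by blast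
          then show ?thesis using zero by simp
        qed
        then show "e \<le> int H + (\<sigma> i + \<sigma> (K - 1 - i) - \<sigma> (K - 1)) - \<nu> (M + w - i) + (\<sigma> k - 1 - (\<sigma> i + \<sigma> (K - 1 - i) - \<sigma> (K - 1)))"
          using nuX h zero e by simp
      qed
    next
      \<comment> \<open>The bounds on E(m) need m \<ge> 1. At m = 0 the exact valuation \<sigma>(k)
        - 1 of F(0) is used, and \<nu>(k) \<le> h makes it enough.\<close>
      case m0
      have i0: "i = 0" using m0 idiv by simp
      have "val_ge (\<sigma> k - 1) (F m)"
        using val_eq_imp_ge[OF val_odd_part_one[of k]] k0 unfolding F_def m0 by simp
      from val_ge_mult[OF L_ge[OF i(1)] this]
      show ?thesis unfolding m_def[symmetric]
      proof (rule val_ge_mono)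
        have "\<nu> (N + u) \<le> \<nu> u"
        proof (rule ccontr)
          assume "\<not> \<nu> (N + u) \<le> \<nu> u"
          then have "2 ^ Suc (multiplicity 2 u) dvd N + u" by (intro multiplicity_dvd') simp
          moreover have "2 ^ Suc (multiplicity 2 u) dvd N"
            using N(1) val_less_of_less_power[OF m0(1) uh]
            by (meson Suc_leI dvd_trans le_imp_power_dvd of_nat_less_iff)
          ultimately have "2 ^ Suc (multiplicity 2 u) dvd u" by (metis dvd_add_right_iff)
          then have "Suc (multiplicity 2 u) \<le> multiplicity 2 u" using m0 by (intro multiplicity_geI) auto
          then show False by simp
        qed
        then show "e \<le> int H + (\<sigma> i + \<sigma> (K - 1 - i) - \<sigma> (K - 1)) - \<nu> (M + w - i) + (\<sigma> k - 1)"
          using nuX h m0 e i0 nuh by simp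
      qed
    next
      case pos
      have "val_ge (\<nu> k + \<sigma> k - 2 - \<nu> m - (\<sigma> i + \<sigma> (K - 1 - i) - \<sigma> (K - 1))) (F m)"
        unfolding F using pos by (intro val_ge_even_part_power[OF k(1) _ mk idiv refl]) simp
      from val_ge_mult[OF L_ge[OF i(1)] this]
      show ?thesis unfolding m_def[symmetric]
      proof (rule val_ge_mono)
        have "\<nu> (N + u - m) + \<nu> m + 1 \<le> int h + \<nu> u"
          using pos mu mh uh Nh N by (intro val_shifted_diff)
        then show "e \<le> int H + (\<sigma> i + \<sigma> (K - 1 - i) - \<sigma> (K - 1)) - \<nu> (M + w - i)
            + (\<nu> k + \<sigma> k - 2 - \<nu> m - (\<sigma> i + \<sigma> (K - 1 - i) - \<sigma> (K - 1)))"
          using nuX h pos e by simp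
      qed
    qed
  qed
  have Fu: "val_ge (e - 1) (F u)"
  proof (cases "u = 0")
    case True
    then show ?thesis using val_eq_imp_ge[OF val_odd_part_one[of k]] k0 unfolding F_def e by simp
  next
    case False
    have "val_ge (\<nu> k + \<sigma> k - 2 - \<nu> u - (\<sigma> w + \<sigma> (K - 1 - w) - \<sigma> (K - 1))) (even_part k (\<lambda>x. of_nat x ^ u))"
      using False w_def by (intro val_ge_even_part_power[OF k(1) _ uk _ refl]) auto
    then show ?thesis unfolding F_def odd_part_power_eq_even_part[OF uk] centre
      by (rule val_ge_mono) (use False e in simp)
  qed
  \<comment> \<open>A 2-adic unit minus 1 is even, which lifts the bound e - 1 for F(u) to
    e.\<close>
  have "val_eq 0 (L w)" unfolding L_def by (rule val_eq_interp_coeff_centre[OF M KH wK])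
  then have "val_ge 1 (L w - 1)"
    using val_eq_add_val_eq[of 0 "L w" "-1"] val_eq_of_int[of "-1"] by simp
  then have "val_ge (1 + (e - 1)) ((L w - 1) * F u)" using Fu by (rule val_ge_mult)
  then have c: "val_ge e ((L w - 1) * F u)" by simp
  have "odd_part k (\<lambda>x. of_nat x ^ (N + u) - of_nat x ^ u) = F (2 * (M + w) + p) - F u"
    unfolding odd_part_diff F_def NM up by (simp add: algebra_simps)
  also have "\<dots> = (L w - 1) * F u + (\<Sum>i\<in>{..<K} - {w}. L i * F (2 * i + p)) + t"
    unfolding t(2) using wK up by (subst sum.remove[of _ w]) (auto simp: algebra_simps)
  also have "val_ge e \<dots>"
  proof (intro val_ge_add c val_ge_sum)
    show "val_ge e t" using t(1) by (rule val_ge_mono) (use nu_pos e in auto)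
  qed (use other in auto)
  finally show ?thesis .
qed

lemma odd_part_times_pred:
  assumes "k \<ge> 1"
  shows "odd_part k (\<lambda>x. of_nat x * f x) = of_nat k * odd_part k f - odd_part (k - 1) f"
  using odd_part_times[of "k - 1" f] assms by simp

text \<open>Odd k is reached from the even number k' = k + 1: \<open>odd_part k f\<close> is k'
  \<open>odd_part k' f\<close> minus the value of \<open>odd_part k'\<close> at x f(x), that is,
  stability at exponents 0 and 1. The bounds fit because \<nu>(k + 1) + \<sigma>(k + 1) =
  \<sigma>(k) + 1.\<close>

lemma odd_part_stable_0:
  assumes "1 \<le> k" "k \<le> 2 ^ h" "h \<ge> 1" and N: "2 ^ h dvd N" "N > 0"
  shows "val_ge (\<sigma> k) (odd_part k (\<lambda>x. of_nat x ^ N - 1))"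
proof (cases "even k")
  case True
  then obtain K where "k = 2 * K" by blast
  then show ?thesis using odd_part_stable_even[of k K h N 0 "\<sigma> k"] assms by simp
next
  case False
  define k' where "k' = Suc k"
  have "even k'" using False unfolding k'_def by simp
  then obtain K where K: "k' = 2 * K" by blast
  have "even ((2::nat) ^ h)" using assms by simp
  then have "k \<noteq> 2 ^ h" using False by metis
  then have k'h: "k' \<le> 2 ^ h" using assms unfolding k'_def by simp
  have mult: "multiplicity 2 k' \<ge> 1"
    using K k'_def multiplicity_two_double[of K] by (cases K) auto
  define f where "f x = rat_of_nat x ^ N - 1" for x
  have "val_ge (\<nu> k' + \<sigma> k') (of_nat k' * odd_part k' f)"
  proof (rule val_ge_mult)
    show "val_ge (\<nu> k') (of_nat k')"
      by (rule val_eq_imp_ge, rule val_eq_of_nat) (simp add: k'_def)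
    show "val_ge (\<sigma> k') (odd_part k' f)"
      unfolding f_def using odd_part_stable_even[of k' K h N 0 "\<sigma> k'"] K k'h N k'_def by simp
  qed
  then have "val_ge (\<sigma> k) (of_nat k' * odd_part k' f)"
    by (rule val_ge_mono) (use digit_sum_Suc[of k] in \<open>simp add: k'_def\<close>)
  moreover have "val_ge (\<sigma> k) (odd_part k' (\<lambda>x. of_nat x * f x))"
  proof -
    have "1 < (2::nat) ^ multiplicity 2 k'" using mult by (intro one_less_power) auto
    then have "val_ge (\<nu> k' + \<sigma> k' - 1 - \<nu> 1) (odd_part k' (\<lambda>x. of_nat x ^ (N + 1) - of_nat x ^ 1))"
      using K k'h N k'_def by (intro odd_part_stable_even[of k' K h]) auto
    moreover have "\<nu> k' + \<sigma> k' - 1 - \<nu> 1 = \<sigma> k"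
      using digit_sum_Suc[of k] by (simp add: k'_def)
    moreover have "(\<lambda>x. rat_of_nat x ^ (N + 1) - of_nat x ^ 1) = (\<lambda>x. of_nat x * f x)"
      unfolding f_def by (simp add: algebra_simps)
    ultimately show ?thesis by (simp only:)
  qed
  ultimately have "val_ge (\<sigma> k) (of_nat k' * odd_part k' f - odd_part k' (\<lambda>x. of_nat x * f x))"
    by (rule val_ge_diff)
  then show ?thesis
    using odd_part_times_pred[of k' f] unfolding f_def k'_def by simp
qed

text \<open>At \<open>u = 2 ^ multiplicity 2 k\<close> the interpolation argument loses precision, because the binomial
  coefficient of the centre node may be even. There the factor \<open>x ^ u\<close> is instead absorbed into
  \<open>k choose x\<close>, which lowers \<open>k\<close>, and stability at exponent 0 suffices.\<close>

fun shift_coeff :: "nat \<Rightarrow> nat \<Rightarrow> nat \<Rightarrow> int"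
  where "shift_coeff k 0 b = (if b = 0 then 1 else 0)"
  | "shift_coeff k (Suc u) b = (int k - int b) * shift_coeff k u b - (if b = 0 then 0 else shift_coeff k u (b - 1))"

lemma shift_coeff_eq_0: "u < b \<Longrightarrow> shift_coeff k u b = 0"
  by (induction u arbitrary: b) auto

lemma odd_part_times_power:
  "u \<le> k \<Longrightarrow> odd_part k (\<lambda>x. of_nat x ^ u * f x) = (\<Sum>b\<le>u. of_int (shift_coeff k u b) * odd_part (k - b) f)"
proof (induction u arbitrary: f)
  case (Suc u)
  define s where "s b = rat_of_int (shift_coeff k u b)" for b
  have "odd_part k (\<lambda>x. of_nat x ^ Suc u * f x) = (\<Sum>b\<le>u. s b * odd_part (k - b) (\<lambda>x. of_nat x * f x))"
    using Suc.IH[of "\<lambda>x. of_nat x * f x"] Suc.prems by (simp add: mult_ac s_def)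
  also have "\<dots> = (\<Sum>b\<le>u. (of_int (int k - int b) * s b) * odd_part (k - b) f - s b * odd_part (k - Suc b) f)"
    using Suc.prems by (intro sum.cong refl) (simp add: odd_part_times_pred of_nat_diff algebra_simps)
  also have "\<dots> = (\<Sum>b\<le>Suc u. (of_int (int k - int b) * s b) * odd_part (k - b) f)
      - (\<Sum>b\<le>Suc u. (if b = 0 then 0 else s (b - 1)) * odd_part (k - b) f)"
  proof -
    have "(\<Sum>b\<le>Suc u. (if b = 0 then 0 else s (b - 1)) * odd_part (k - b) f) = (\<Sum>b\<le>u. s b * odd_part (k - Suc b) f)"
      by (subst sum.atMost_Suc_shift) simp
    moreover have "s (Suc u) = 0" unfolding s_def by (simp add: shift_coeff_eq_0)
    ultimately show ?thesis by (simp add: sum_subtractf)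
  qed
  also have "\<dots> = (\<Sum>b\<le>Suc u. of_int (shift_coeff k (Suc u) b) * odd_part (k - b) f)"
    unfolding sum_subtractf[symmetric] by (intro sum.cong refl) (simp add: s_def algebra_simps)
  finally show ?case .
qed simp

text \<open>Modulo k the factor k - b becomes -b, and the recursion turns into that of (-1)^u S(u,
  b). This makes the digit sum bound available, with \<sigma>(u) = 1 for a power of two.\<close>

lemma shift_coeff_cong: "int k dvd shift_coeff k u b - (-1) ^ u * int (Stirling u b)"
proof (induction u arbitrary: b)
  case (Suc u)
  show ?case
  proof (cases b)
    case 0
    then show ?thesis using Suc[of 0] by simp
  next
    case (Suc c)
    obtain y where "shift_coeff k u b - (-1) ^ u * int (Stirling u b) = int k * y"
      using Suc.IH[of b] by (elim dvdE)
    then have y: "shift_coeff k u b = (-1) ^ u * int (Stirling u b) + int k * y" by simp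
    obtain z where "shift_coeff k u c - (-1) ^ u * int (Stirling u c) = int k * z"
      using Suc.IH[of c] by (elim dvdE)
    then have z: "shift_coeff k u c = (-1) ^ u * int (Stirling u c) + int k * z" by simp
    have "shift_coeff k (Suc u) b - (-1) ^ Suc u * int (Stirling (Suc u) b)
        = int k * (shift_coeff k u b - int b * y - z)"
      unfolding shift_coeff.simps using y z Suc by (simp add: algebra_simps)
    then show ?thesis by simp
  qed
qed (cases b; simp)

lemma odd_part_stable_power:
  assumes "even k" "k \<le> 2 ^ h" and N: "2 ^ h dvd N" "N > 0" and u: "u = 2 ^ a" "u < k" "a = multiplicity 2 k"
  shows "val_ge (\<sigma> k - 1) (odd_part k (\<lambda>x. of_nat x ^ (N + u) - of_nat x ^ u))"
proof -
  define f where "f x = rat_of_nat x ^ N - 1" for x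
  have k: "k > 0" using u by simp
  have a: "a \<ge> 1" using assms(1) k unfolding u(3) by (intro multiplicity_geI) auto
  have "k \<ge> 2" using u(2) unfolding u(1) by (rule order_trans[rotated, OF Suc_leI]) simp
  then have h: "h \<ge> 1" using assms(2) by (cases h) auto
  have su: "\<sigma> u = 1" unfolding u(1) using digit_sum_mult_power[of a 1] by simp
  have "(\<lambda>x. rat_of_nat x ^ (N + u) - of_nat x ^ u) = (\<lambda>x. of_nat x ^ u * f x)"
    unfolding f_def by (simp add: algebra_simps power_add)
  then have "odd_part k (\<lambda>x. of_nat x ^ (N + u) - of_nat x ^ u) = (\<Sum>b\<le>u. of_int (shift_coeff k u b) * odd_part (k - b) f)"
    using odd_part_times_power[of u k f] u by simp
  also have "val_ge (\<sigma> k - 1) \<dots>"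
  proof (rule val_ge_sum)
    fix b assume "b \<in> {..u}"
    then have b: "b \<le> u" "b < k" using u by auto
    have f: "val_ge (\<sigma> (k - b)) (odd_part (k - b) f)"
      unfolding f_def using b assms h N by (intro odd_part_stable_0) auto
    have sb: "\<sigma> k \<le> \<sigma> (k - b) + \<sigma> b" using b by (intro digit_sum_diff_le) simp
    obtain z where "shift_coeff k u b - (-1) ^ u * int (Stirling u b) = int k * z"
      using shift_coeff_cong[of k u b] by (elim dvdE)
    then have "shift_coeff k u b = (-1) ^ u * int (Stirling u b) + int k * z" by simp
    then have "rat_of_int (shift_coeff k u b) = (-1) ^ u * of_nat (Stirling u b) + of_nat k * of_int z"
      by simp
    moreover have "val_ge (\<sigma> b - 1) (\<dots>)"
    proof (rule val_ge_add)
      show "val_ge (\<sigma> b - 1) ((-1) ^ u * of_nat (Stirling u b))"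
        using val_ge_Stirling_digit_sum[of b u] su by (cases "even u") simp_all
      \<comment> \<open>b \<le> 2^a forces \<sigma>(b) \<le> a = \<nu>(k), so the multiple of k left
        by the congruence is harmless.\<close>
      have "(2::nat) ^ binary_digit_sum b \<le> Suc (2 ^ a)"
        using two_power_digit_sum_le[of b] b u by (meson Suc_le_mono le_trans)
      also have "Suc (2 ^ a) < 2 ^ Suc a"
        using one_less_power[of "2::nat" a] a by simp
      finally have "binary_digit_sum b \<le> a" by (simp only: power_strict_increasing_iff)
      moreover have "val_ge (\<nu> k + 0) (of_nat k * of_int z)"
        using k by (intro val_ge_mult val_eq_imp_ge[OF val_eq_of_nat] val_ge_of_int)
      ultimately show "val_ge (\<sigma> b - 1) (of_nat k * of_int z)"
        using u by (auto elim: val_ge_mono)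
    qed
    ultimately have "val_ge (\<sigma> b - 1 + \<sigma> (k - b)) (of_int (shift_coeff k u b) * odd_part (k - b) f)"
      using f by (simp only:) (rule val_ge_mult)
    then show "val_ge (\<sigma> k - 1) (of_int (shift_coeff k u b) * odd_part (k - b) f)"
      by (rule val_ge_mono) (use sb in simp)
  qed
  finally show ?thesis .
qed

lemma odd_part_stable:
  assumes "k \<le> 2 ^ h" and N: "2 ^ h dvd N" "N > 0" and u: "1 \<le> u" "u < k" "u \<le> 2 ^ multiplicity 2 k"
  shows "val_ge (\<nu> k + \<sigma> k - 1 - \<nu> u) (odd_part k (\<lambda>x. of_nat x ^ (N + u) - of_nat x ^ u))"
proof (cases "even k")
  case True
  then obtain K where K: "k = 2 * K" by blast
  show ?thesis
  proof (cases "u = 2 ^ multiplicity 2 k")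
    case True
    have "\<nu> u = \<nu> k" by (subst True) simp
    then show ?thesis using odd_part_stable_power[OF \<open>even k\<close> assms(1) N True u(2) refl] by simp
  next
    case False
    then show ?thesis using odd_part_stable_even[OF K _ assms(1) N, of u] u K by simp
  qed
next
  case False
  then have nu: "\<nu> k = 0" by (simp add: multiplicity_two_odd)
  \<comment> \<open>For odd k only u = 1 occurs, and x^(N + 1) - x = x (x^N - 1) reduces to exponent
    0 at k and k - 1.\<close>
  then have u1: "u = 1" using u by simp
  have h: "h \<ge> 1" using assms(1) u by (cases h) auto
  define f where "f x = rat_of_nat x ^ N - 1" for x
  have "(\<lambda>x. rat_of_nat x ^ (N + u) - of_nat x ^ u) = (\<lambda>x. of_nat x * f x)"
    unfolding f_def u1 by (simp add: algebra_simps)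
  then have "odd_part k (\<lambda>x. of_nat x ^ (N + u) - of_nat x ^ u) = of_nat k * odd_part k f - odd_part (k - 1) f"
    using odd_part_times_pred[of k f] u by simp
  also have "val_ge (\<sigma> k - 1) \<dots>"
  proof (rule val_ge_diff)
    have "val_ge (0 + \<sigma> k) (of_nat k * odd_part k f)"
      unfolding f_def using assms h u by (intro val_ge_mult val_ge_of_nat odd_part_stable_0) auto
    then show "val_ge (\<sigma> k - 1) (of_nat k * odd_part k f)" by (rule val_ge_mono) simp
    have "val_ge (\<sigma> (k - 1)) (odd_part (k - 1) f)"
      unfolding f_def using assms h u by (intro odd_part_stable_0) auto
    then show "val_ge (\<sigma> k - 1) (odd_part (k - 1) f)"
      using digit_sum_pred[of k] nu u by simp
  qed
  finally show ?thesis using nu u1 by simp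
qed

section \<open>Valuation of Stirling numbers\<close>

lemma val_Stirling:
  assumes "k \<le> 2 ^ h" and N: "2 ^ h dvd N" "N > 0" and u: "1 \<le> u" "u < k" "u \<le> 2 ^ a" and a: "a = multiplicity 2 k"
    and e: "e = \<nu> k + \<sigma> k - 2 - \<nu> u"
  shows "if u = 1 \<or> even u \<and> 2 * u \<le> 2 ^ a \<or> 2 * (u - 1) = 2 ^ a \<or> u = 2 ^ a
    then val_eq e (of_nat (Stirling (N + u) k))
    else val_ge (e + 1) (of_nat (Stirling (N + u) k))"
proof -
  have k2: "k \<ge> 2" using u by simp
  define n where "n = N + u"
  have "n > k" using assms(1) dvd_imp_le[OF N] u unfolding n_def by simp
  define E where "E m = even_part k (\<lambda>x. of_nat x ^ m)" for m
  define t where "t = E n - odd_part k (\<lambda>x. of_nat x ^ n - of_nat x ^ u)"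
  have "val_ge (e + 1) (E n)"
    unfolding E_def using val_ge_even_part_high_power[OF k2 \<open>n > k\<close>] by (rule val_ge_mono) (simp add: e)
  moreover have "val_ge (e + 1) (odd_part k (\<lambda>x. of_nat x ^ n - of_nat x ^ u))"
    using odd_part_stable[OF assms(1) N u(1,2) u(3)[unfolded a]] unfolding n_def
    by (rule val_ge_mono) (simp_all add: e)
  ultimately have t: "val_ge (e + 1) t" unfolding t_def by (rule val_ge_diff)
  have S: "(-1) ^ k * of_nat (Stirling n k) = - E u + t"
    using even_part_minus_odd_part[of k n] odd_part_power_eq_even_part[OF u(2)]
    unfolding E_def t_def odd_part_diff by simp
  have "val_eq e (of_nat (Stirling n k)) \<longleftrightarrow> val_eq e ((-1) ^ k * of_nat (Stirling n k))"
    "val_ge (e + 1) (of_nat (Stirling n k)) \<longleftrightarrow> val_ge (e + 1) ((-1) ^ k * of_nat (Stirling n k))"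
    by (cases "even k"; simp)+
  note sgn = this[unfolded S]
  have "val_eq e (E u) \<Longrightarrow> val_eq e (of_nat (Stirling n k))"
    unfolding sgn using t by (intro val_eq_add) simp_all
  moreover have "val_ge (e + 1) (E u) \<Longrightarrow> val_ge (e + 1) (of_nat (Stirling n k))"
    unfolding sgn using t by (intro val_ge_add) simp_all
  ultimately show ?thesis
    using val_even_part_small_power[OF k2 u a e] unfolding E_def n_def by (auto split: if_splits)
qed

text \<open>Modulo 2, two steps of the Stirling recurrence amount to Pascal's rule. The case u = k
  needs this separate argument: S(k, k) is not 0, so F(k) and E(k) differ.\<close>

lemma odd_Stirling_double_iff:
  "odd (Stirling (2 * Suc q + j) (2 * Suc q)) \<longleftrightarrow> odd ((q + j) choose j)"
proof (induction "q + j" arbitrary: q j rule: less_induct)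
  case less
  have rec: "odd (Stirling (2 * Suc q + j) (2 * Suc q)) \<longleftrightarrow> odd (Stirling (2 * q + Suc j) (2 * q + 1))" for q j
    by simp
  have rec': "odd (Stirling (2 * q + Suc (Suc j)) (2 * q + 1)) \<longleftrightarrow>
      (odd (Stirling (2 * q + Suc j) (2 * q + 1)) \<noteq> odd (Stirling (2 * q + Suc j) (2 * q)))" for q j
    using Stirling.simps(4)[of "2 * q + Suc j" "2 * q"] by (simp del: Stirling.simps)
  show ?case
  proof (cases j)
    case 0
    then show ?thesis by simp
  next
    case j: (Suc i)
    have main: "odd (Stirling (2 * Suc q + j) (2 * Suc q)) \<longleftrightarrow>
        (odd (Stirling (2 * Suc q + i) (2 * Suc q)) \<noteq> odd (Stirling (2 * q + j) (2 * q)))"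
      unfolding rec j rec' ..
    show ?thesis
    proof (cases q)
      case 0
      then show ?thesis unfolding main using less[of q i] j by simp
    next
      case (Suc p)
      have "odd (Stirling (2 * Suc q + i) (2 * Suc q)) \<longleftrightarrow> odd ((q + i) choose i)"
        using less[of q i] j by simp
      moreover have "odd (Stirling (2 * q + j) (2 * q)) \<longleftrightarrow> odd ((p + j) choose j)"
        using less[of p j] Suc by simp
      moreover have "(q + j) choose j = ((q + i) choose i) + ((p + j) choose j)"
        unfolding Suc j by simp
      ultimately show ?thesis unfolding main by simp
    qed
  qed
qed

lemma odd_Stirling_power_two:
  assumes "2 ^ a dvd N"
  shows "odd (Stirling (N + 2 ^ a) (2 ^ a))"
proof (cases a)
  case 0
  then show ?thesis using Stirling_1[of N] by (simp del: Stirling.simps)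
next
  case (Suc b)
  obtain m where N: "N = 2 ^ a * m" using assms by (elim dvdE)
  \<comment> \<open>q + 1 is half of 2^a. As q < 2^a and 2^a divides N, the sum q + N is carry-free,
    and Kummer's theorem applies.\<close>
  define q where "q = (2::nat) ^ b - 1"
  have q: "2 ^ a = 2 * Suc q" unfolding q_def Suc by simp
  then have q': "q < 2 ^ a" by simp
  have "\<sigma> (q + N) = \<sigma> q + \<sigma> N"
    unfolding N using digit_sum_split[OF q', of m] by (simp add: add.commute)
  then have "val_eq 0 (of_nat ((q + N) choose N))"
    using val_eq_binomial[of N q] by (simp add: add.commute)
  then have "odd ((q + N) choose N)"
    using val_eq_of_nat_iff[of "(q + N) choose N" 0] by (auto simp: multiplicity_eq_zero_iff)
  then show ?thesis unfolding q using odd_Stirling_double_iff[of q N] by (simp add: add.commute)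
qed

lemma nu2_ge_iff: "nu2 s \<ge> ereal (of_int e) \<longleftrightarrow> val_ge e (of_nat s)"
  by (cases "s = 0") (auto simp: nu2_def val_ge_of_nat_iff of_int_le_iff[symmetric, where 'a = real] simp del: of_int_le_iff)

lemma nu2_eq_iff: "nu2 s = ereal (of_int e) \<longleftrightarrow> val_eq e (of_nat s)"
proof (cases "s = 0")
  case True
  then show ?thesis using val_eq_nonzero[of e 0] by (auto simp: nu2_def)
next
  case False
  have "real (multiplicity 2 s) = of_int e \<longleftrightarrow> e = \<nu> s" by linarith
  then show ?thesis using False by (simp add: nu2_def val_eq_of_nat_iff)
qed

theorem theorem2p5:
  fixes h c k u :: nat
  assumes "1 \<le> k" and "k \<le> 2 ^ h"
    and "1 \<le> u" and "u \<le> 2 ^ multiplicity 2 k"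
  shows
    "(u < k \<longrightarrow>
       nu2 (Stirling (c * 2 ^ h + u) k) \<ge> nu2 k + ereal (real (binary_digit_sum k)) - nu2 u - 2)
     \<and>
     (c \<ge> 1 \<and> u < k \<longrightarrow>
       (nu2 (Stirling (c * 2 ^ h + u) k) = nu2 k + ereal (real (binary_digit_sum k)) - nu2 u - 2
        \<longleftrightarrow>
        u = 1
        \<or> (even u \<and> 1 \<le> u \<and> real u \<le> 2 powi (int (multiplicity 2 k) - 1))
        \<or> real u = 1 + 2 powi (int (multiplicity 2 k) - 1)
        \<or> u = 2 ^ multiplicity 2 k))
     \<and>
     (u = k \<longrightarrow>
       binary_digit_sum k = 1 \<and> nu2 (Stirling (c * 2 ^ h + u) k) = 0)"
proof -
  define a where "a = multiplicity 2 k"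
  define e where "e = \<nu> k + \<sigma> k - 2 - \<nu> u"
  define S where "S = Stirling (c * 2 ^ h + u) k"
  have rhs: "nu2 k + ereal (real (binary_digit_sum k)) - nu2 u - 2 = ereal (of_int e)"
    using assms by (simp add: nu2_def e_def numeral_eq_ereal)
  \<comment> \<open>For odd k the exponent is -1. Doubling turns the conditions into statements
    about natural numbers.\<close>
  have half: "(2::real) powi (int a - 1) = 2 ^ a / 2"
    by (simp add: power_int_diff)
  have le_half: "real u \<le> 2 powi (int a - 1) \<longleftrightarrow> 2 * u \<le> 2 ^ a"
  proof -
    have "real u \<le> 2 ^ a / 2 \<longleftrightarrow> real (2 * u) \<le> real (2 ^ a)" by (simp add: mult.commute)
    then show ?thesis unfolding half by (simp only: of_nat_le_iff)
  qed
  have eq_half: "real u = 1 + 2 powi (int a - 1) \<longleftrightarrow> 2 * (u - 1) = 2 ^ a"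
  proof -
    have "real u = 1 + 2 ^ a / 2 \<longleftrightarrow> real (2 * (u - 1)) = real (2 ^ a)"
      using assms by (auto simp: of_nat_diff field_simps)
    then show ?thesis unfolding half by (simp only: of_nat_eq_iff)
  qed
  have val: "if u = 1 \<or> even u \<and> 2 * u \<le> 2 ^ a \<or> 2 * (u - 1) = 2 ^ a \<or> u = 2 ^ a
    then val_eq e (of_nat S) else val_ge (e + 1) (of_nat S)" if "c \<ge> 1" "u < k"
    unfolding S_def using assms that a_def e_def by (intro val_Stirling) auto
  have "val_ge e (of_nat S)" if "u < k"
  proof (cases "c \<ge> 1")
    case True
    show ?thesis using val[OF True that] val_eq_imp_ge val_ge_mono[of "e + 1" _ e]
      by (auto split: if_splits)
  next
    case False
    \<comment> \<open>Here the Stirling number is 0 and its valuation infinite, so the lower bound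
      survives but equality could not.\<close>
    then have "c = 0" by simp
    then have "S = 0" using that unfolding S_def by simp
    then show ?thesis by simp
  qed
  moreover have "val_eq e (of_nat S) \<longleftrightarrow>
      u = 1 \<or> even u \<and> 2 * u \<le> 2 ^ a \<or> 2 * (u - 1) = 2 ^ a \<or> u = 2 ^ a" if "c \<ge> 1" "u < k"
    using val[OF that] val_eq_not_ge[of e "of_nat S"] by (auto split: if_splits)
  moreover have "binary_digit_sum k = 1 \<and> nu2 S = 0" if "u = k"
  proof
    have "2 ^ a dvd k" unfolding a_def by (rule multiplicity_dvd)
    then have "2 ^ a \<le> k" using assms by (intro dvd_imp_le) auto
    then have k: "k = 2 ^ a" using assms(4) that unfolding a_def by simp
    then show "binary_digit_sum k = 1"
      using digit_sum_mult_power[of a 1] by simp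
    have "(2::nat) ^ a \<le> 2 ^ h" using assms(2) k by simp
    then have "a \<le> h" by (rule power_le_imp_le_exp[rotated]) simp
    then have "2 ^ a dvd c * 2 ^ h" by (simp add: le_imp_power_dvd)
    then have "odd S" unfolding S_def that using odd_Stirling_power_two[of a "c * 2 ^ h"] k by simp
    then show "nu2 S = 0" using odd_pos[of S] by (simp add: nu2_def multiplicity_two_odd zero_ereal_def)
  qed
  ultimately show ?thesis
    unfolding S_def[symmetric] a_def[symmetric] rhs nu2_ge_iff nu2_eq_iff le_half eq_half
    using assms(3) by blast
qed

end
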